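(* Let $G_0$ be a finite group, $A$ a finite $G_0$-module and $\pi_0\in Z^1(G_0,A)$ a bijective 1-cocycle (that is, $(G_0,A,\pi_0)$ is an $I$-datum on the involutive Yang-Baxter group $G_0$). Fix an embedding $\rho:G_0\hookrightarrow S_n$, and regard $\mathbb{Z}^n$ as a (faithful) $G_0$-module via the corresponding permutation action on its standard generators. Then there is a one-to-one correspondence between (a) groups $G<\mathbb{Z}^n\rtimes S_n$ of $I$-type, with $n$-fold $I$-datum $(G,\mathbb{Z}^n,\pi)$, whose associated $I$-datum is $(G_0,A,\pi_0)$; and (b) $n$-fold permutation extensions of $G_0$-modules $$0\to\ker\theta\to\mathbb{Z}^n\xrightarrow{\ \theta\ }A\to 0:\qquad[\gamma_\theta]\in\mathrm{Ext}^1_{G_0}(A,\ker\theta),$$ arising from surjective $G_0$-module maps $\theta:\mathbb{Z}^n\twoheadrightarrow A$. The correspondence is realized by the Yoneda splicing $[\gamma_\theta]\mapsto[\gamma_\theta]\circ[\pi_0]\in H^2(G_0,\ker\theta)$. That is, if $G$ corresponds to $\theta$ and $K$ denotes the kernel of the action of $G$ on $\mathbb{Z}^n$, then $\pi$ restricts to an isomorphism $K\to\ker\theta$, the map $\theta$ satisfies $\theta(\pi(g))=\pi_0(gK)$ for all $g\in G$ (identifying $G/K$ with $G_0$), and the extension $1\to \ker\theta\cong K\to G\to G_0\to 1$ has class $[\gamma_\theta]\circ[\pi_0]$.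
   Context: For a group $H$ and an (additively written) $H$-module $M$, a 1-cocycle $\pi\in Z^1(H,M)$ is a map $\pi:H\to M$ with $\pi(gh)=\pi(g)+g\pi(h)$. Groups of $I$-type: let $S_n$ act on $\mathbb{Z}^n$ by permuting the standard generators. The projection $\mathbb{Z}^n\rtimes S_n\to\mathbb{Z}^n$, $(t,\sigma)\mapsto t$, is a 1-cocycle, where $\mathbb{Z}^n\rtimes S_n$ acts on $\mathbb{Z}^n$ through $S_n$. A subgroup $G<\mathbb{Z}^n\rtimes S_n$ is of $I$-type if the restriction $\pi:G\to\mathbb{Z}^n$ of this projection is bijective. The triple $(G,\mathbb{Z}^n,\pi)$ is then called an $n$-fold $I$-datum on $G$. Associated $I$-datum: given an $n$-fold $I$-datum $(G,\mathbb{Z}^n,\pi)$, let $K$ be the kernel of the action of $G$ on $\mathbb{Z}^n$, that is, $K=\{(t,\sigma)\in G:\sigma=1\}$. Then $\pi|_K$ is an injective group homomorphism, the finite group $G/K$ embeds in $S_n$, $\pi(K)$ is a $G/K$-submodule of $\mathbb{Z}^n$, and $gK\mapsto\pi(g)+\pi(K)$ is a bijective 1-cocycle $G/K\to\mathbb{Z}^n/\pi(K)$. The triple formed by $G/K$, $\mathbb{Z}^n/\pi(K)$ and this 1-cocycle is the associated $I$-datum. A finite group admitting a bijective 1-cocycle to a module (an $I$-datum) is called involutive Yang-Baxter (IYB). "The associated $I$-datum of $(G,\mathbb{Z}^n,\pi)$ is $(G_0,A,\pi_0)$" means: the image of $G$ in $S_n$ is $\rho(G_0)$, so that $G/K$ is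 identified with $G_0$ via $\rho$; and there is an isomorphism of $G_0$-modules $f:\mathbb{Z}^n/\pi(K)\to A$ with $f(\pi(g)+\pi(K))=\pi_0(gK)$ for all $g\in G$. Permutation extensions are indexed by the surjective $G_0$-module maps $\theta$. Here $\ker\theta$ is a $G_0$-submodule of $\mathbb{Z}^n$ which, as an abelian group, is free of rank $n$. Yoneda splicing: under $H^i(G_0,M)\cong\mathrm{Ext}^i_{G_0}(\mathbb{Z},M)$, the class $[\gamma_\theta]\circ[\pi_0]\in H^2(G_0,\ker\theta)$ is the image of $[\pi_0]\in H^1(G_0,A)$ under the connecting homomorphism $H^1(G_0,A)\to H^2(G_0,\ker\theta)$ of the short exact sequence. Explicitly, for any set-theoretic section $a\mapsto\overline a$ of $\theta$, it is the class of $(g_1,g_2)\mapsto\overline{\pi_0(g_1)}+g_1\overline{\pi_0(g_2)}-\overline{\pi_0(g_1g_2)}$. The class of a group extension $1\to M\to G\to G_0\to1$ with abelian kernel $M$ is the class in $H^2(G_0,M)$ of $(g_1,g_2)\mapsto\overline{g_1}\,\overline{g_2}\,(\overline{g_1g_2})^{-1}$ for any set-theoretic section $g\mapsto\overline g$, where $G_0$ acts on $M$ by conjugation. *)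

theory Defs
  imports "HOL-Algebra.Product_Groups" "HOL-Algebra.Sym_Groups"
begin

text \<open>
  Modules over a group are written multiplicatively, as commutative groups of HOL-Algebra:
  \<open>\<otimes>\<close>, \<open>\<one>\<close> and \<open>inv\<close> are the sum, zero and negation of the module.
\<close>

section \<open>Modules over a group\<close>

record ('g, 'm) gmod = "'m monoid" +
  act :: "'g \<Rightarrow> 'm \<Rightarrow> 'm"

locale gmodule = G: group G + M: comm_group M
  for G :: "('g, 'b) monoid_scheme" and M :: "('g, 'm, 'c) gmod_scheme" +
  assumes act_hom: "g \<in> carrier G \<Longrightarrow> act M g \<in> hom M M"
    and act_one: "m \<in> carrier M \<Longrightarrow> act M \<one>\<^bsub>G\<^esub> m = m"
    and act_mult: "\<lbrakk>g \<in> carrier G; h \<in> carrier G; m \<in> carrier M\<rbrakk>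
      \<Longrightarrow> act M (g \<otimes>\<^bsub>G\<^esub> h) m = act M g (act M h m)"

definition gmod_hom ::
  "('g, 'b) monoid_scheme \<Rightarrow> ('g, 'm, 'c) gmod_scheme \<Rightarrow> ('g, 'n, 'd) gmod_scheme \<Rightarrow> ('m \<Rightarrow> 'n) set"
  where "gmod_hom G M N =
    {f \<in> hom M N. \<forall>g\<in>carrier G. \<forall>m\<in>carrier M. f (act M g m) = act N g (f m)}"

definition gmod_iso ::
  "('g, 'b) monoid_scheme \<Rightarrow> ('g, 'm, 'c) gmod_scheme \<Rightarrow> ('g, 'n, 'd) gmod_scheme \<Rightarrow> ('m \<Rightarrow> 'n) set"
  where "gmod_iso G M N = gmod_hom G M N \<inter> iso M N"

definition quotient_gmod :: "('g, 'm, 'c) gmod_scheme \<Rightarrow> 'm set \<Rightarrow> ('g, 'm set) gmod"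
  where "quotient_gmod M N =
    \<lparr>carrier = carrier (M Mod N), monoid.mult = monoid.mult (M Mod N), one = one (M Mod N),
     act = (\<lambda>g C. act M g ` C)\<rparr>"


section \<open>Group cohomology in degrees 1 and 2\<close>

text \<open>Inhomogeneous cochains, as extensional functions with pointwise operations.\<close>

definition C1 :: "('g, 'b) monoid_scheme \<Rightarrow> ('g, 'm, 'c) gmod_scheme \<Rightarrow> ('g \<Rightarrow> 'm) monoid"
  where "C1 G M = product_group (carrier G) (\<lambda>_. M)"

definition C2 :: "('g, 'b) monoid_scheme \<Rightarrow> ('g, 'm, 'c) gmod_scheme \<Rightarrow> ('g \<times> 'g \<Rightarrow> 'm) monoid"
  where "C2 G M = product_group (carrier G \<times> carrier G) (\<lambda>_. M)"

definition Z1 :: "('g, 'b) monoid_scheme \<Rightarrow> ('g, 'm, 'c) gmod_scheme \<Rightarrow> ('g \<Rightarrow> 'm) set"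
  where "Z1 G M = {f \<in> carrier (C1 G M). \<forall>g\<in>carrier G. \<forall>h\<in>carrier G.
    f (g \<otimes>\<^bsub>G\<^esub> h) = f g \<otimes>\<^bsub>M\<^esub> act M g (f h)}"

definition B1 :: "('g, 'b) monoid_scheme \<Rightarrow> ('g, 'm, 'c) gmod_scheme \<Rightarrow> ('g \<Rightarrow> 'm) set"
  where "B1 G M = (\<lambda>m. \<lambda>g\<in>carrier G. act M g m \<otimes>\<^bsub>M\<^esub> inv\<^bsub>M\<^esub> m) ` carrier M"

definition Z2 :: "('g, 'b) monoid_scheme \<Rightarrow> ('g, 'm, 'c) gmod_scheme \<Rightarrow> ('g \<times> 'g \<Rightarrow> 'm) set"
  where "Z2 G M = {c \<in> carrier (C2 G M). \<forall>g\<in>carrier G. \<forall>h\<in>carrier G. \<forall>k\<in>carrier G.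
    act M g (c (h, k)) \<otimes>\<^bsub>M\<^esub> c (g, h \<otimes>\<^bsub>G\<^esub> k) = c (g \<otimes>\<^bsub>G\<^esub> h, k) \<otimes>\<^bsub>M\<^esub> c (g, h)}"

definition B2 :: "('g, 'b) monoid_scheme \<Rightarrow> ('g, 'm, 'c) gmod_scheme \<Rightarrow> ('g \<times> 'g \<Rightarrow> 'm) set"
  where "B2 G M = (\<lambda>f. \<lambda>(g, h)\<in>carrier G \<times> carrier G.
    act M g (f h) \<otimes>\<^bsub>M\<^esub> inv\<^bsub>M\<^esub> f (g \<otimes>\<^bsub>G\<^esub> h) \<otimes>\<^bsub>M\<^esub> f g) ` carrier (C1 G M)"

definition H1 :: "('g, 'b) monoid_scheme \<Rightarrow> ('g, 'm, 'c) gmod_scheme \<Rightarrow> ('g \<Rightarrow> 'm) set monoid"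
  where "H1 G M = (C1 G M)\<lparr>carrier := Z1 G M\<rparr> Mod B1 G M"

definition H2 :: "('g, 'b) monoid_scheme \<Rightarrow> ('g, 'm, 'c) gmod_scheme \<Rightarrow> ('g \<times> 'g \<Rightarrow> 'm) set monoid"
  where "H2 G M = (C2 G M)\<lparr>carrier := Z2 G M\<rparr> Mod B2 G M"

definition H1_class ::
  "('g, 'b) monoid_scheme \<Rightarrow> ('g, 'm, 'c) gmod_scheme \<Rightarrow> ('g \<Rightarrow> 'm) \<Rightarrow> ('g \<Rightarrow> 'm) set"
  where "H1_class G M f = B1 G M #>\<^bsub>C1 G M\<^esub> f"

definition H2_class ::
  "('g, 'b) monoid_scheme \<Rightarrow> ('g, 'm, 'c) gmod_scheme \<Rightarrow> ('g \<times> 'g \<Rightarrow> 'm) \<Rightarrow> ('g \<times> 'g \<Rightarrow> 'm) set"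
  where "H2_class G M c = B2 G M #>\<^bsub>C2 G M\<^esub> c"

definition set_sections :: "('e \<Rightarrow> 'a) \<Rightarrow> 'e set \<Rightarrow> 'a set \<Rightarrow> ('a \<Rightarrow> 'e) set"
  where "set_sections p E A = {s \<in> A \<rightarrow> E. \<forall>a\<in>A. p (s a) = a}"


section \<open>Extensions of modules and Yoneda splicing\<close>

text \<open>The triple \<open>(E, i, p)\<close> stands for \<open>0 \<rightarrow> M \<rightarrow> E \<rightarrow> A \<rightarrow> 0\<close> with maps \<open>i\<close> and \<open>p\<close>.\<close>

type_synonym ('g, 'm, 'e, 'a) gmod_extension = "('g, 'e) gmod \<times> ('m \<Rightarrow> 'e) \<times> ('e \<Rightarrow> 'a)"

definition gmod_extensions ::
  "('g, 'b) monoid_scheme \<Rightarrow> ('g, 'a) gmod \<Rightarrow> ('g, 'm) gmod \<Rightarrow> ('g, 'm, 'e, 'a) gmod_extension set"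
  where "gmod_extensions G A M = {(E, i, p).
    gmodule G M \<and> gmodule G E \<and> gmodule G A \<and>
    i \<in> gmod_hom G M E \<and> i \<in> mon M E \<and>
    p \<in> gmod_hom G E A \<and> p \<in> epi E A \<and>
    i ` carrier M = kernel E A p}"

definition yoneda_equiv ::
  "('g, 'b) monoid_scheme \<Rightarrow> ('g, 'a) gmod \<Rightarrow> ('g, 'm) gmod \<Rightarrow>
    (('g, 'm, 'e, 'a) gmod_extension \<times> ('g, 'm, 'e, 'a) gmod_extension) set"
  where "yoneda_equiv G A M = {((E, i, p), (E', i', p')).
    (E, i, p) \<in> gmod_extensions G A M \<and> (E', i', p') \<in> gmod_extensions G A M \<and>
    (\<exists>f\<in>gmod_iso G E E'.
      (\<forall>m\<in>carrier M. f (i m) = i' m) \<and> (\<forall>e\<in>carrier E. p' (f e) = p e))}"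

text \<open>
  \<open>Ext\<^sup>1(A, M)\<close> as a set of Yoneda classes. HOL forces the middle terms to live in one type
  \<open>'e\<close>; for countable \<open>A\<close> and \<open>M\<close> every class is represented as soon as \<open>'e\<close> is infinite.
\<close>

definition Ext1 ::
  "('g, 'b) monoid_scheme \<Rightarrow> ('g, 'a) gmod \<Rightarrow> ('g, 'm) gmod \<Rightarrow> ('g, 'm, 'e, 'a) gmod_extension set set"
  where "Ext1 G A M = gmod_extensions G A M // yoneda_equiv G A M"

definition Ext1_class ::
  "('g, 'b) monoid_scheme \<Rightarrow> ('g, 'a) gmod \<Rightarrow> ('g, 'm) gmod \<Rightarrow>
    ('g, 'm, 'e, 'a) gmod_extension \<Rightarrow> ('g, 'm, 'e, 'a) gmod_extension set"
  where "Ext1_class G A M X = yoneda_equiv G A M `` {X}"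

definition splice_cocycle ::
  "('g, 'b) monoid_scheme \<Rightarrow> ('g, 'm) gmod \<Rightarrow> ('g, 'e) gmod \<Rightarrow> ('m \<Rightarrow> 'e) \<Rightarrow>
    ('a \<Rightarrow> 'e) \<Rightarrow> ('g \<Rightarrow> 'a) \<Rightarrow> 'g \<times> 'g \<Rightarrow> 'm"
  where "splice_cocycle G M E i s f = (\<lambda>(g, h)\<in>carrier G \<times> carrier G.
    inv_into (carrier M) i
      (s (f g) \<otimes>\<^bsub>E\<^esub> act E g (s (f h)) \<otimes>\<^bsub>E\<^esub> inv\<^bsub>E\<^esub> s (f (g \<otimes>\<^bsub>G\<^esub> h))))"

text \<open>
  A map that is given on representatives is rendered as the union of the classes of all choices,
  here of a cocycle and of a set-theoretic section. The union is itself a class, that is, an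
  element of \<open>carrier (H2 G M)\<close>, exactly when all choices give the same class.
\<close>

definition connecting_hom ::
  "('g, 'b) monoid_scheme \<Rightarrow> ('g, 'a) gmod \<Rightarrow> ('g, 'm) gmod \<Rightarrow> ('g, 'm, 'e, 'a) gmod_extension \<Rightarrow>
    ('g \<Rightarrow> 'a) set \<Rightarrow> ('g \<times> 'g \<Rightarrow> 'm) set"
  where "connecting_hom G A M = (\<lambda>(E, i, p) c.
    \<Union>f\<in>c. \<Union>s\<in>set_sections p (carrier E) (carrier A). H2_class G M (splice_cocycle G M E i s f))"

definition yoneda_splice ::
  "('g, 'b) monoid_scheme \<Rightarrow> ('g, 'a) gmod \<Rightarrow> ('g, 'm) gmod \<Rightarrow> ('g, 'm, 'e, 'a) gmod_extension set \<Rightarrow>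
    ('g \<Rightarrow> 'a) set \<Rightarrow> ('g \<times> 'g \<Rightarrow> 'm) set"
  where "yoneda_splice G A M \<gamma> c = (\<Union>X\<in>\<gamma>. connecting_hom G A M X c)"


section \<open>Group extensions with abelian kernel\<close>

text \<open>\<open>1 \<rightarrow> M \<rightarrow> E \<rightarrow> G \<rightarrow> 1\<close> with maps \<open>j\<close> and \<open>q\<close>, inducing on \<open>M\<close> its given \<open>G\<close>-action.\<close>

definition group_extension ::
  "('g, 'b) monoid_scheme \<Rightarrow> ('g, 'm) gmod \<Rightarrow> ('e, 'd) monoid_scheme \<Rightarrow> ('m \<Rightarrow> 'e) \<Rightarrow> ('e \<Rightarrow> 'g) \<Rightarrow> bool"
  where "group_extension G M E j q \<longleftrightarrow>
    gmodule G M \<and> group E \<and> j \<in> mon M E \<and> q \<in> epi E G \<and> j ` carrier M = kernel E G q \<and>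
    (\<forall>e\<in>carrier E. \<forall>m\<in>carrier M. j (act M (q e) m) = e \<otimes>\<^bsub>E\<^esub> j m \<otimes>\<^bsub>E\<^esub> inv\<^bsub>E\<^esub> e)"

definition extension_class ::
  "('g, 'b) monoid_scheme \<Rightarrow> ('g, 'm) gmod \<Rightarrow> ('e, 'd) monoid_scheme \<Rightarrow> ('m \<Rightarrow> 'e) \<Rightarrow> ('e \<Rightarrow> 'g) \<Rightarrow>
    ('g \<times> 'g \<Rightarrow> 'm) set"
  where "extension_class G M E j q = (\<Union>s\<in>set_sections q (carrier E) (carrier G).
    H2_class G M (\<lambda>(g, h)\<in>carrier G \<times> carrier G.
      inv_into (carrier M) j (s g \<otimes>\<^bsub>E\<^esub> s h \<otimes>\<^bsub>E\<^esub> inv\<^bsub>E\<^esub> s (g \<otimes>\<^bsub>G\<^esub> h))))"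


section \<open>Groups of I-type\<close>

definition Zn :: "nat \<Rightarrow> (nat \<Rightarrow> int) monoid"
  where "Zn n = product_group {1..n} (\<lambda>_. integer_group)"

text \<open>The inverse makes \<open>\<sigma>\<close> send the \<open>i\<close>-th standard generator to the \<open>\<sigma> i\<close>-th one.\<close>

definition perm_act :: "nat \<Rightarrow> (nat \<Rightarrow> nat) \<Rightarrow> (nat \<Rightarrow> int) \<Rightarrow> (nat \<Rightarrow> int)"
  where "perm_act n \<sigma> t = (\<lambda>i\<in>{1..n}. t (inv_into UNIV \<sigma> i))"

definition semidirect ::
  "('n, 'b) monoid_scheme \<Rightarrow> ('h, 'c) monoid_scheme \<Rightarrow> ('h \<Rightarrow> 'n \<Rightarrow> 'n) \<Rightarrow> ('n \<times> 'h) monoid"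
  where "semidirect N H \<phi> =
    \<lparr>carrier = carrier N \<times> carrier H,
     monoid.mult = (\<lambda>(t, \<sigma>) (u, \<tau>). (t \<otimes>\<^bsub>N\<^esub> \<phi> \<sigma> u, \<sigma> \<otimes>\<^bsub>H\<^esub> \<tau>)),
     one = (\<one>\<^bsub>N\<^esub>, \<one>\<^bsub>H\<^esub>)\<rparr>"

definition ZnSn :: "nat \<Rightarrow> ((nat \<Rightarrow> int) \<times> (nat \<Rightarrow> nat)) monoid"
  where "ZnSn n = semidirect (Zn n) (sym_group n) (perm_act n)"

text \<open>The cocycle \<open>\<pi>\<close> of the I-datum is \<^const>\<open>fst\<close>.\<close>

definition I_type :: "nat \<Rightarrow> ((nat \<Rightarrow> int) \<times> (nat \<Rightarrow> nat)) set \<Rightarrow> bool"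
  where "I_type n G \<longleftrightarrow> subgroup G (ZnSn n) \<and> bij_betw fst G (carrier (Zn n))"

definition act_kernel ::
  "nat \<Rightarrow> ((nat \<Rightarrow> int) \<times> (nat \<Rightarrow> nat)) set \<Rightarrow> ((nat \<Rightarrow> int) \<times> (nat \<Rightarrow> nat)) set"
  where "act_kernel n G = {g \<in> G. snd g = \<one>\<^bsub>sym_group n\<^esub>}"

definition perm_module :: "nat \<Rightarrow> ('g \<Rightarrow> nat \<Rightarrow> nat) \<Rightarrow> ('g, nat \<Rightarrow> int) gmod"
  where "perm_module n \<rho> =
    \<lparr>carrier = carrier (Zn n), monoid.mult = monoid.mult (Zn n), one = one (Zn n),
     act = (\<lambda>x. perm_act n (\<rho> x))\<rparr>"

text \<open>The composite \<open>G \<rightarrow> G/K \<cong> G\<^sub>0\<close>, where \<open>G/K\<close> is identified with \<open>G\<^sub>0\<close> via \<open>\<rho>\<close>.\<close>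

definition to_G0 ::
  "('g, 'b) monoid_scheme \<Rightarrow> ('g \<Rightarrow> nat \<Rightarrow> nat) \<Rightarrow> (nat \<Rightarrow> int) \<times> (nat \<Rightarrow> nat) \<Rightarrow> 'g"
  where "to_G0 G0 \<rho> g = inv_into (carrier G0) \<rho> (snd g)"

definition has_assoc_I_datum ::
  "nat \<Rightarrow> ((nat \<Rightarrow> int) \<times> (nat \<Rightarrow> nat)) set \<Rightarrow> ('g, 'b) monoid_scheme \<Rightarrow> ('g \<Rightarrow> nat \<Rightarrow> nat) \<Rightarrow>
    ('g, 'a) gmod \<Rightarrow> ('g \<Rightarrow> 'a) \<Rightarrow> bool"
  where "has_assoc_I_datum n G G0 \<rho> A \<pi>0 \<longleftrightarrow>
    snd ` G = \<rho> ` carrier G0 \<and>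
    (\<exists>f\<in>gmod_iso G0 (quotient_gmod (perm_module n \<rho>) (fst ` act_kernel n G)) A.
      \<forall>g\<in>G. f (fst ` act_kernel n G #>\<^bsub>Zn n\<^esub> fst g) = \<pi>0 (to_G0 G0 \<rho> g))"


section \<open>Permutation extensions\<close>

text \<open>
  Permutation extensions are indexed by surjective module maps \<open>\<theta>\<close>; extensionality makes each
  map \<open>\<int>\<^sup>n \<rightarrow> A\<close> be a single HOL function.
\<close>

definition perm_ext_maps ::
  "nat \<Rightarrow> ('g, 'b) monoid_scheme \<Rightarrow> ('g \<Rightarrow> nat \<Rightarrow> nat) \<Rightarrow> ('g, 'a) gmod \<Rightarrow> ((nat \<Rightarrow> int) \<Rightarrow> 'a) set"
  where "perm_ext_maps n G0 \<rho> A =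
    {\<theta> \<in> gmod_hom G0 (perm_module n \<rho>) A \<inter> extensional (carrier (Zn n)).
      \<theta> ` carrier (Zn n) = carrier A}"

definition ker_module ::
  "nat \<Rightarrow> ('g \<Rightarrow> nat \<Rightarrow> nat) \<Rightarrow> ('g, 'a) gmod \<Rightarrow> ((nat \<Rightarrow> int) \<Rightarrow> 'a) \<Rightarrow> ('g, nat \<Rightarrow> int) gmod"
  where "ker_module n \<rho> A \<theta> = (perm_module n \<rho>)\<lparr>carrier := kernel (Zn n) A \<theta>\<rparr>"

definition perm_extension ::
  "nat \<Rightarrow> ('g \<Rightarrow> nat \<Rightarrow> nat) \<Rightarrow> ((nat \<Rightarrow> int) \<Rightarrow> 'a) \<Rightarrow> ('g, nat \<Rightarrow> int, nat \<Rightarrow> int, 'a) gmod_extension"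
  where "perm_extension n \<rho> \<theta> = (perm_module n \<rho>, id, \<theta>)"

definition perm_ext_class ::
  "nat \<Rightarrow> ('g, 'b) monoid_scheme \<Rightarrow> ('g \<Rightarrow> nat \<Rightarrow> nat) \<Rightarrow> ('g, 'a) gmod \<Rightarrow> ((nat \<Rightarrow> int) \<Rightarrow> 'a) \<Rightarrow>
    ('g, nat \<Rightarrow> int, nat \<Rightarrow> int, 'a) gmod_extension set"
  where "perm_ext_class n G0 \<rho> A \<theta> =
    Ext1_class G0 A (ker_module n \<rho> A \<theta>) (perm_extension n \<rho> \<theta>)"

end

(*
  A group G of I-type is the graph of a map from Z^n to S_n. If G lies over G_0, then pi_0 turns
  this map into theta = pi_0 o q o pi^-1 : Z^n -> A, where q : G -> G_0, and theta recovers G as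
  {(t, rho x). theta t = pi_0 x}. For a surjective module map theta the
  cocycle identities for pi and pi_0 make this set a subgroup.
  The extension class needs no separate analysis of sections: pi carries a section S of q to
  the section pi o S o pi_0^-1 of theta, and the two 2-cocycles coincide, so that independence of
  all choices on the side of the module extension settles both sides.
*)
theory Submission
  imports Defs
begin

section \<open>Cohomology classes\<close>

text \<open>Injectivity of \<open>\<pi>0\<close> makes the element of \<open>G0\<close> attached to
  a given \<open>t\<close> unique, so that the fibre product of \<open>\<theta>\<close> and
  \<open>\<pi>0\<close> is a graph over Z^n; surjectivity provides such an element for every
  \<open>t\<close>. On the cohomological side the obstacle is that the connecting map, the splice
  and the extension class are unions over all choices: each is one class only after independence of
  the cocycle in its H1-class, of the section, and of the extension in its Yoneda class. A section
  \<open>s\<close> and a cocycle \<open>f\<close> enter only through \<open>s \<circ> f\<close>,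
  which suggests working with arbitrary functions \<open>u : G -> E\<close> over \<open>f\<close>.
  If \<open>f'\<close> is cohomologous to \<open>f\<close>, any function over \<open>f'\<close>
  differs from \<open>u\<close> by a function with values in \<open>M\<close> plus a principal term
  \<open>g e - e\<close>; the former changes the 2-cocycle by a coboundary, the latter not at all.
  An isomorphism of extensions preserves the 2-cocycle exactly. Such identities are checked after
  applying an injective map: \<open>i\<close> for values in \<open>M\<close>, \<open>fst\<close> for
  elements of a group of I-type.\<close>

context comm_group
begin

lemma mult_inv_cancel_left:
  "\<lbrakk>x \<in> carrier G; y \<in> carrier G\<rbrakk> \<Longrightarrow> x \<otimes> (inv x \<otimes> y) = y"
  by (simp flip: m_assoc)

text \<open>
  Replacing a lift \<open>u\<close> by \<open>g \<mapsto> m g + u g + (g e - e)\<close> changes its 2-cocycle by the coboundary of \<open>m\<close>;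
  here \<open>x, y, z\<close> stand for \<open>g e, e, g h e\<close>.
\<close>
lemma cocycle_shift:
  assumes [simp]: "a \<in> carrier G" "b \<in> carrier G" "c \<in> carrier G" "x \<in> carrier G"
    "y \<in> carrier G" "z \<in> carrier G" "p \<in> carrier G" "q \<in> carrier G" "r \<in> carrier G"
  shows "(p \<otimes> a \<otimes> (x \<otimes> inv y)) \<otimes> (q \<otimes> b \<otimes> (z \<otimes> inv x)) \<otimes> inv (r \<otimes> c \<otimes> (z \<otimes> inv y))
    = (q \<otimes> inv r \<otimes> p) \<otimes> (a \<otimes> b \<otimes> inv c)"
proof -
  \<comment> \<open>AC rewriting sorts factors but cancels nothing, so the three pairs in
    \<open>x\<close>, \<open>y\<close>, \<open>z\<close> are kept explicitly in front and removed
    afterwards.\<close>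
  have "(p \<otimes> a \<otimes> (x \<otimes> inv y)) \<otimes> (q \<otimes> b \<otimes> (z \<otimes> inv x)) \<otimes> inv (r \<otimes> c \<otimes> (z \<otimes> inv y))
    = x \<otimes> (inv x \<otimes> (y \<otimes> (inv y \<otimes> (z \<otimes> (inv z \<otimes> ((q \<otimes> inv r \<otimes> p) \<otimes> (a \<otimes> b \<otimes> inv c)))))))"
    by (simp add: inv_mult m_ac)
  then show ?thesis
    by (simp add: mult_inv_cancel_left)
qed

text \<open>This becomes the 2-cocycle identity, with \<open>a, b, c, d, f\<close> standing for
  \<open>g u(h)\<close>, \<open>gh u(k)\<close>, \<open>g u(hk)\<close>, \<open>u(ghk)\<close>,
  \<open>u(gh)\<close> and \<open>u\<close> for \<open>u(g)\<close>. On the left \<open>c\<close>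
  cancels, on the right \<open>f\<close>; both sides are \<open>a + b + u - d\<close>.\<close>

lemma cocycle_telescope:
  assumes [simp]: "a \<in> carrier G" "b \<in> carrier G" "c \<in> carrier G" "d \<in> carrier G"
    "f \<in> carrier G" "u \<in> carrier G"
  shows "(a \<otimes> b \<otimes> inv c) \<otimes> (u \<otimes> c \<otimes> inv d) = (f \<otimes> b \<otimes> inv d) \<otimes> (u \<otimes> a \<otimes> inv f)"
proof -
  have "(a \<otimes> b \<otimes> inv c) \<otimes> (u \<otimes> c \<otimes> inv d) = c \<otimes> (inv c \<otimes> (a \<otimes> b \<otimes> u \<otimes> inv d))"
    by (simp add: m_ac)
  also have "\<dots> = f \<otimes> (inv f \<otimes> (a \<otimes> b \<otimes> u \<otimes> inv d))"
    by (simp add: mult_inv_cancel_left)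
  also have "\<dots> = (f \<otimes> b \<otimes> inv d) \<otimes> (u \<otimes> a \<otimes> inv f)"
    by (simp add: m_ac)
  finally show ?thesis .
qed

end

section \<open>Cochains, coboundaries and equality of classes for a fixed module\<close>

context gmodule
begin

lemma act_closed [simp]:
  "\<lbrakk>g \<in> carrier G; m \<in> carrier M\<rbrakk> \<Longrightarrow> act M g m \<in> carrier M"
  using act_hom by (auto simp: hom_def)

lemma act_add:
  "\<lbrakk>g \<in> carrier G; m \<in> carrier M; m' \<in> carrier M\<rbrakk>
    \<Longrightarrow> act M g (m \<otimes>\<^bsub>M\<^esub> m') = act M g m \<otimes>\<^bsub>M\<^esub> act M g m'"
  using act_hom by (auto simp: hom_def)

lemma act_group_hom: "g \<in> carrier G \<Longrightarrow> group_hom M M (act M g)"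
  by (simp add: group_hom_def group_hom_axioms_def act_hom M.is_group)

lemma act_zero: "g \<in> carrier G \<Longrightarrow> act M g \<one>\<^bsub>M\<^esub> = \<one>\<^bsub>M\<^esub>"
  by (rule group_hom.hom_one[OF act_group_hom])

lemma act_inv:
  "\<lbrakk>g \<in> carrier G; m \<in> carrier M\<rbrakk> \<Longrightarrow> act M g (inv\<^bsub>M\<^esub> m) = inv\<^bsub>M\<^esub> act M g m"
  by (rule group_hom.hom_inv[OF act_group_hom])

lemma C2_group: "group (C2 G M)"
  unfolding C2_def by (simp add: M.is_group)

text \<open>\<open>B2\<close> ranges over extensional cochains, but a coboundary only sees values on
  the carrier, so restricting an arbitrary function does no harm.\<close>

lemma cobound_in_B2:
  assumes "f \<in> carrier G \<rightarrow> carrier M"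
  shows "(\<lambda>(g, h)\<in>carrier G \<times> carrier G.
    act M g (f h) \<otimes>\<^bsub>M\<^esub> inv\<^bsub>M\<^esub> f (g \<otimes>\<^bsub>G\<^esub> h) \<otimes>\<^bsub>M\<^esub> f g) \<in> B2 G M"
  unfolding B2_def
  by (rule image_eqI[where x = "restrict f (carrier G)"]) (use assms in \<open>auto simp: C1_def\<close>)

lemma B2E:
  assumes "b \<in> B2 G M"
  obtains f where "f \<in> carrier G \<rightarrow> carrier M"
    and "b = (\<lambda>(g, h)\<in>carrier G \<times> carrier G.
      act M g (f h) \<otimes>\<^bsub>M\<^esub> inv\<^bsub>M\<^esub> f (g \<otimes>\<^bsub>G\<^esub> h) \<otimes>\<^bsub>M\<^esub> f g)"
  using assms unfolding B2_def C1_def by auto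

lemma B2_subset: "B2 G M \<subseteq> carrier (C2 G M)"
proof
  fix b assume "b \<in> B2 G M"
  then obtain f where "f \<in> carrier G \<rightarrow> carrier M"
    and beq: "b = (\<lambda>(g, h)\<in>carrier G \<times> carrier G.
      act M g (f h) \<otimes>\<^bsub>M\<^esub> inv\<^bsub>M\<^esub> f (g \<otimes>\<^bsub>G\<^esub> h) \<otimes>\<^bsub>M\<^esub> f g)"
    by (rule B2E)
  then show "b \<in> carrier (C2 G M)"
    unfolding C2_def beq by (auto simp: Pi_iff)
qed

text \<open>The coboundary is additive in the 1-cochain: negatives and sums come from
  \<open>- f\<close> and \<open>f + k\<close>. The subgroup property is what lets cosets be compared
  through representatives.\<close>

lemma B2_subgroup: "subgroup (B2 G M) (C2 G M)"
proof (rule group.subgroupI[OF C2_group B2_subset])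
  show "B2 G M \<noteq> {}"
    using cobound_in_B2[of "\<lambda>_. \<one>\<^bsub>M\<^esub>"] by auto
next
  fix b assume b: "b \<in> B2 G M"
  then obtain f where f: "f \<in> carrier G \<rightarrow> carrier M"
    and beq: "b = (\<lambda>(g, h)\<in>carrier G \<times> carrier G.
      act M g (f h) \<otimes>\<^bsub>M\<^esub> inv\<^bsub>M\<^esub> f (g \<otimes>\<^bsub>G\<^esub> h) \<otimes>\<^bsub>M\<^esub> f g)"
    by (rule B2E)
  have "inv\<^bsub>C2 G M\<^esub> b = (\<lambda>x\<in>carrier G \<times> carrier G. inv\<^bsub>M\<^esub> b x)"
    unfolding C2_def
    by (rule inv_product_group) (use b B2_subset M.is_group in \<open>auto simp: C2_def\<close>)
  also have "\<dots> = (\<lambda>(g, h)\<in>carrier G \<times> carrier G. act M g (inv\<^bsub>M\<^esub> f h)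
      \<otimes>\<^bsub>M\<^esub> inv\<^bsub>M\<^esub> (inv\<^bsub>M\<^esub> f (g \<otimes>\<^bsub>G\<^esub> h)) \<otimes>\<^bsub>M\<^esub> inv\<^bsub>M\<^esub> f g)"
    unfolding beq using f
    by (intro restrict_ext) (auto simp: Pi_iff act_inv M.inv_mult)
  also have "\<dots> \<in> B2 G M"
    by (rule cobound_in_B2) (use f in auto)
  finally show "inv\<^bsub>C2 G M\<^esub> b \<in> B2 G M" .
next
  fix b c assume b: "b \<in> B2 G M" and c: "c \<in> B2 G M"
  from b obtain f where f: "f \<in> carrier G \<rightarrow> carrier M"
    and beq: "b = (\<lambda>(g, h)\<in>carrier G \<times> carrier G.
      act M g (f h) \<otimes>\<^bsub>M\<^esub> inv\<^bsub>M\<^esub> f (g \<otimes>\<^bsub>G\<^esub> h) \<otimes>\<^bsub>M\<^esub> f g)"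
    by (rule B2E)
  from c obtain k where k: "k \<in> carrier G \<rightarrow> carrier M"
    and ceq: "c = (\<lambda>(g, h)\<in>carrier G \<times> carrier G.
      act M g (k h) \<otimes>\<^bsub>M\<^esub> inv\<^bsub>M\<^esub> k (g \<otimes>\<^bsub>G\<^esub> h) \<otimes>\<^bsub>M\<^esub> k g)"
    by (rule B2E)
  have "b \<otimes>\<^bsub>C2 G M\<^esub> c = (\<lambda>(g, h)\<in>carrier G \<times> carrier G. act M g (f h \<otimes>\<^bsub>M\<^esub> k h)
      \<otimes>\<^bsub>M\<^esub> inv\<^bsub>M\<^esub> (f (g \<otimes>\<^bsub>G\<^esub> h) \<otimes>\<^bsub>M\<^esub> k (g \<otimes>\<^bsub>G\<^esub> h)) \<otimes>\<^bsub>M\<^esub> (f g \<otimes>\<^bsub>M\<^esub> k g))"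
    unfolding C2_def beq ceq mult_product_group using f k
    by (intro restrict_ext) (auto simp: Pi_iff act_add M.inv_mult M.m_ac)
  also have "\<dots> \<in> B2 G M"
    by (rule cobound_in_B2) (use f k in auto)
  finally show "b \<otimes>\<^bsub>C2 G M\<^esub> c \<in> B2 G M" .
qed

text \<open>\<open>H2_class\<close> is a coset of \<open>B2\<close> inside the whole cochain group,
  so a difference by a coboundary already settles equality for cochains.\<close>

lemma H2_class_eqI:
  assumes c: "c \<in> carrier (C2 G M)" and c': "c' \<in> carrier (C2 G M)"
    and f: "f \<in> carrier G \<rightarrow> carrier M"
    and eq: "\<And>g h. \<lbrakk>g \<in> carrier G; h \<in> carrier G\<rbrakk> \<Longrightarrow>
      c' (g, h) = act M g (f h) \<otimes>\<^bsub>M\<^esub> inv\<^bsub>M\<^esub> f (g \<otimes>\<^bsub>G\<^esub> h) \<otimes>\<^bsub>M\<^esub> f g \<otimes>\<^bsub>M\<^esub> c (g, h)"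
  shows "H2_class G M c = H2_class G M c'"
proof -
  define b where "b = (\<lambda>(g, h)\<in>carrier G \<times> carrier G.
    act M g (f h) \<otimes>\<^bsub>M\<^esub> inv\<^bsub>M\<^esub> f (g \<otimes>\<^bsub>G\<^esub> h) \<otimes>\<^bsub>M\<^esub> f g)"
  have "b \<in> B2 G M"
    unfolding b_def by (rule cobound_in_B2[OF f])
  moreover have "c' = b \<otimes>\<^bsub>C2 G M\<^esub> c"
  proof (rule extensionalityI[of _ "carrier G \<times> carrier G"])
    show "c' \<in> extensional (carrier G \<times> carrier G)"
      using c' by (simp add: C2_def PiE_def)
  qed (auto simp: C2_def b_def eq)
  ultimately have "c' \<in> B2 G M #>\<^bsub>C2 G M\<^esub> c"
    unfolding r_coset_def by blast
  then show ?thesis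
    unfolding H2_class_def by (rule group.repr_independence[OF C2_group _ c B2_subgroup])
qed

lemma H2_class_in_carrier: "c \<in> Z2 G M \<Longrightarrow> H2_class G M c \<in> carrier (H2 G M)"
  unfolding H2_class_def H2_def FactGroup_def RCOSETS_def r_coset_def by auto

lemma Z1_subset: "Z1 G M \<subseteq> carrier G \<rightarrow> carrier M"
  by (auto simp: Z1_def C1_def)

lemma H1_classE:
  assumes "f' \<in> H1_class G M f"
  obtains m where "m \<in> carrier M"
    and "\<And>g. g \<in> carrier G \<Longrightarrow> f' g = act M g m \<otimes>\<^bsub>M\<^esub> inv\<^bsub>M\<^esub> m \<otimes>\<^bsub>M\<^esub> f g"
  using assms unfolding H1_class_def r_coset_def B1_def C1_def by auto

text \<open>The coboundary of zero is trivial. The result keeps the union over a class in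
  \<open>connecting_hom\<close> from being empty.\<close>

lemma H1_class_self:
  assumes "f \<in> Z1 G M"
  shows "f \<in> H1_class G M f"
proof -
  have f: "f \<in> carrier G \<rightarrow>\<^sub>E carrier M"
    using assms by (simp add: Z1_def C1_def)
  then have "f = (\<lambda>g\<in>carrier G. act M g \<one>\<^bsub>M\<^esub> \<otimes>\<^bsub>M\<^esub> inv\<^bsub>M\<^esub> \<one>\<^bsub>M\<^esub>) \<otimes>\<^bsub>C1 G M\<^esub> f"
    by (intro extensionalityI[of _ "carrier G"]) (auto simp: C1_def act_zero PiE_iff)
  moreover have "(\<lambda>g\<in>carrier G. act M g \<one>\<^bsub>M\<^esub> \<otimes>\<^bsub>M\<^esub> inv\<^bsub>M\<^esub> \<one>\<^bsub>M\<^esub>) \<in> B1 G M"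
    unfolding B1_def by blast
  ultimately show ?thesis
    unfolding H1_class_def r_coset_def by blast
qed

lemma H1_class_subset_Z1:
  assumes f: "f \<in> Z1 G M"
  shows "H1_class G M f \<subseteq> Z1 G M"
proof
  fix f' assume f': "f' \<in> H1_class G M f"
  obtain m where m [simp]: "m \<in> carrier M"
    and f'_eq: "\<And>g. g \<in> carrier G \<Longrightarrow> f' g = act M g m \<otimes>\<^bsub>M\<^esub> inv\<^bsub>M\<^esub> m \<otimes>\<^bsub>M\<^esub> f g"
    using f' by (rule H1_classE) blast
  have [simp]: "f g \<in> carrier M" if "g \<in> carrier G" for g
    using that f Z1_subset by auto
  have "f' \<in> extensional (carrier G)"
    using f' by (auto simp: H1_class_def r_coset_def C1_def)
  then have "f' \<in> carrier (C1 G M)"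
    by (auto simp: C1_def PiE_iff f'_eq)
  moreover have "f' (g \<otimes>\<^bsub>G\<^esub> h) = f' g \<otimes>\<^bsub>M\<^esub> act M g (f' h)"
    if [simp]: "g \<in> carrier G" "h \<in> carrier G" for g h
  proof -
    \<comment> \<open>The term \<open>g m\<close> from \<open>f' g\<close> meets
      \<open>- g m\<close> from \<open>g (f' h)\<close>; what remains is the principal term at
      \<open>gh\<close> and the cocycle identity of \<open>f\<close>.\<close>
    have "f' g \<otimes>\<^bsub>M\<^esub> act M g (f' h) = act M g m \<otimes>\<^bsub>M\<^esub> (inv\<^bsub>M\<^esub> act M g m
        \<otimes>\<^bsub>M\<^esub> (act M (g \<otimes>\<^bsub>G\<^esub> h) m \<otimes>\<^bsub>M\<^esub> inv\<^bsub>M\<^esub> m \<otimes>\<^bsub>M\<^esub> (f g \<otimes>\<^bsub>M\<^esub> act M g (f h))))"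
      by (simp add: f'_eq act_add act_inv act_mult M.m_ac)
    also have "\<dots> = f' (g \<otimes>\<^bsub>G\<^esub> h)"
      using f by (simp add: M.mult_inv_cancel_left f'_eq Z1_def)
    finally show ?thesis ..
  qed
  ultimately show "f' \<in> Z1 G M"
    by (simp add: Z1_def)
qed

end

section \<open>Splicing a 1-cocycle with a module extension\<close>

lemma gmod_homD:
  assumes "f \<in> gmod_hom G M N"
  shows "f \<in> hom M N"
    and "\<lbrakk>g \<in> carrier G; m \<in> carrier M\<rbrakk> \<Longrightarrow> f (act M g m) = act N g (f m)"
  using assms by (auto simp: gmod_hom_def)

text \<open>A union over all sections can only be a class if some section exists; surjectivity and
  choice supply one.\<close>

lemma set_sections_nonempty:
  assumes "p ` E = A"
  shows "set_sections p E A \<noteq> {}"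
proof -
  have "inv_into E p \<in> set_sections p E A"
    using assms by (auto simp: set_sections_def inv_into_into f_inv_into_f)
  then show ?thesis by blast
qed

locale gmod_extension =
  fixes G :: "('g, 'b) monoid_scheme" and A :: "('g, 'a) gmod" and M :: "('g, 'm) gmod"
    and E :: "('g, 'e) gmod" and i :: "'m \<Rightarrow> 'e" and p :: "'e \<Rightarrow> 'a"
  assumes ext: "(E, i, p) \<in> gmod_extensions G A M"
begin

sublocale M: gmodule G M using ext by (simp add: gmod_extensions_def)
sublocale E: gmodule G E using ext by (simp add: gmod_extensions_def)
sublocale A: gmodule G A using ext by (simp add: gmod_extensions_def)

lemma i_gmod_hom: "i \<in> gmod_hom G M E" and i_inj: "inj_on i (carrier M)"
  and p_gmod_hom: "p \<in> gmod_hom G E A" and p_surj: "p ` carrier E = carrier A"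
  and i_image: "i ` carrier M = kernel E A p"
  using ext by (auto simp: gmod_extensions_def mon_def epi_def)

sublocale i: group_hom M E i
  using gmod_homD(1)[OF i_gmod_hom]
  by (simp add: group_hom_def group_hom_axioms_def E.M.is_group M.M.is_group)

sublocale p: group_hom E A p
  using gmod_homD(1)[OF p_gmod_hom]
  by (simp add: group_hom_def group_hom_axioms_def E.M.is_group A.M.is_group)

lemmas i_act = gmod_homD(2)[OF i_gmod_hom]
lemmas p_act = gmod_homD(2)[OF p_gmod_hom]

text \<open>Varying \<open>u\<close> over all functions above \<open>f\<close> treats the choice of
  section without ever naming a section.\<close>

definition lifts :: "('g \<Rightarrow> 'a) \<Rightarrow> ('g \<Rightarrow> 'e) set"
  where "lifts f = {u \<in> carrier G \<rightarrow> carrier E. \<forall>g\<in>carrier G. p (u g) = f g}"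

definition lift_cocycle :: "('g \<Rightarrow> 'e) \<Rightarrow> 'g \<times> 'g \<Rightarrow> 'm"
  where "lift_cocycle u = (\<lambda>(g, h)\<in>carrier G \<times> carrier G.
    inv_into (carrier M) i
      (u g \<otimes>\<^bsub>E\<^esub> act E g (u h) \<otimes>\<^bsub>E\<^esub> inv\<^bsub>E\<^esub> u (g \<otimes>\<^bsub>G\<^esub> h)))"

lemma splice_cocycle_eq: "splice_cocycle G M E i s f = lift_cocycle (s \<circ> f)"
  by (simp add: splice_cocycle_def lift_cocycle_def)

lemma section_lift:
  "\<lbrakk>s \<in> set_sections p (carrier E) (carrier A); f \<in> Z1 G A\<rbrakk> \<Longrightarrow> s \<circ> f \<in> lifts f"
  using A.Z1_subset by (fastforce simp: lifts_def set_sections_def)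

context
  fixes f u
  assumes f: "f \<in> Z1 G A" and u: "u \<in> lifts f"
begin

lemma lift_closed [simp]: "g \<in> carrier G \<Longrightarrow> u g \<in> carrier E"
  using u by (auto simp: lifts_def)

lemma lift_proj: "g \<in> carrier G \<Longrightarrow> p (u g) = f g"
  using u by (auto simp: lifts_def)

lemma Z1_closed [simp]: "g \<in> carrier G \<Longrightarrow> f g \<in> carrier A"
  using f A.Z1_subset by auto

text \<open>The expression measures how far \<open>u\<close> is from being a 1-cocycle. Its image
  under \<open>p\<close> is the same expression for \<open>f\<close>, which vanishes, and exactness
  does the rest.\<close>

lemma lift_defect:
  assumes [simp]: "g \<in> carrier G" "h \<in> carrier G"
  shows "u g \<otimes>\<^bsub>E\<^esub> act E g (u h) \<otimes>\<^bsub>E\<^esub> inv\<^bsub>E\<^esub> u (g \<otimes>\<^bsub>G\<^esub> h) \<in> i ` carrier M"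
proof -
  have "f (g \<otimes>\<^bsub>G\<^esub> h) = f g \<otimes>\<^bsub>A\<^esub> act A g (f h)"
    using f by (simp add: Z1_def)
  then have "p (u g \<otimes>\<^bsub>E\<^esub> act E g (u h) \<otimes>\<^bsub>E\<^esub> inv\<^bsub>E\<^esub> u (g \<otimes>\<^bsub>G\<^esub> h)) = \<one>\<^bsub>A\<^esub>"
    by (simp add: p_act lift_proj)
  then show ?thesis
    by (simp add: i_image kernel_def)
qed

text \<open>Replaces the \<open>inv_into\<close> of the definition by an equation in
  \<open>E\<close>; later computations use only this equation and injectivity of
  \<open>i\<close>.\<close>

lemma i_lift_cocycle:
  assumes "g \<in> carrier G" "h \<in> carrier G"
  shows "i (lift_cocycle u (g, h)) = u g \<otimes>\<^bsub>E\<^esub> act E g (u h) \<otimes>\<^bsub>E\<^esub> inv\<^bsub>E\<^esub> u (g \<otimes>\<^bsub>G\<^esub> h)"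
  using f_inv_into_f[OF lift_defect[OF assms]] by (simp add: lift_cocycle_def assms)

lemma lift_cocycle_closed:
  assumes "g \<in> carrier G" "h \<in> carrier G"
  shows "lift_cocycle u (g, h) \<in> carrier M"
  using inv_into_into[OF lift_defect[OF assms]] by (simp add: lift_cocycle_def assms)

lemma lift_cocycle_C2: "lift_cocycle u \<in> carrier (C2 G M)"
  using lift_cocycle_closed by (auto simp: C2_def PiE_iff) (auto simp: lift_cocycle_def)

text \<open>Seen in \<open>E\<close>, the cochain is the coboundary of \<open>u\<close>, hence
  satisfies the cocycle identity there; injectivity of \<open>i\<close> brings the identity back to
  \<open>M\<close>.\<close>

lemma lift_cocycle_Z2: "lift_cocycle u \<in> Z2 G M"
proof -
  have "act M g (lift_cocycle u (h, k)) \<otimes>\<^bsub>M\<^esub> lift_cocycle u (g, h \<otimes>\<^bsub>G\<^esub> k)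
      = lift_cocycle u (g \<otimes>\<^bsub>G\<^esub> h, k) \<otimes>\<^bsub>M\<^esub> lift_cocycle u (g, h)"
    if [simp]: "g \<in> carrier G" "h \<in> carrier G" "k \<in> carrier G" for g h k
  proof (rule inj_onD[OF i_inj])
    show "i (act M g (lift_cocycle u (h, k)) \<otimes>\<^bsub>M\<^esub> lift_cocycle u (g, h \<otimes>\<^bsub>G\<^esub> k))
      = i (lift_cocycle u (g \<otimes>\<^bsub>G\<^esub> h, k) \<otimes>\<^bsub>M\<^esub> lift_cocycle u (g, h))"
      using E.M.cocycle_telescope[of "act E g (u h)" "act E (g \<otimes>\<^bsub>G\<^esub> h) (u k)"
        "act E g (u (h \<otimes>\<^bsub>G\<^esub> k))" "u (g \<otimes>\<^bsub>G\<^esub> h \<otimes>\<^bsub>G\<^esub> k)" "u (g \<otimes>\<^bsub>G\<^esub> h)" "u g"]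
      by (simp add: i_lift_cocycle lift_cocycle_closed i_act E.act_add E.act_inv E.act_mult
          M.G.m_assoc)
  qed (simp_all add: lift_cocycle_closed)
  then show ?thesis
    using lift_cocycle_C2 by (simp add: Z2_def)
qed

end

lemma lift_cocycle_class_eq:
  assumes f: "f \<in> Z1 G A" and f': "f' \<in> Z1 G A" and coh: "f' \<in> H1_class G A f"
    and u: "u \<in> lifts f" and u': "u' \<in> lifts f'"
  shows "H2_class G M (lift_cocycle u) = H2_class G M (lift_cocycle u')"
proof -
  note [simp] = lift_closed[OF f u] lift_closed[OF f' u'] 
    lift_cocycle_closed[OF f u] lift_cocycle_closed[OF f' u']
  obtain a where a: "a \<in> carrier A"
    and f'_eq: "\<And>g. g \<in> carrier G \<Longrightarrow> f' g = act A g a \<otimes>\<^bsub>A\<^esub> inv\<^bsub>A\<^esub> a \<otimes>\<^bsub>A\<^esub> f g"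
    using coh by (rule A.H1_classE) blast
  obtain e where e [simp]: "e \<in> carrier E" and pe: "p e = a"
    using a unfolding p_surj[symmetric] by auto
  \<comment> \<open>Since \<open>g e - e\<close> lies over \<open>g a - a\<close>, the function
    \<open>w\<close> is again over \<open>f'\<close>, so \<open>u' - w\<close> takes values in the
    image of \<open>i\<close>. That difference, pulled back to \<open>M\<close>, is the cobounding
    function \<open>m\<close>.\<close>
  define w where "w g = u g \<otimes>\<^bsub>E\<^esub> (act E g e \<otimes>\<^bsub>E\<^esub> inv\<^bsub>E\<^esub> e)" for g
  have w [simp]: "w g \<in> carrier E" if "g \<in> carrier G" for g
    using that by (simp add: w_def)
  have "p (u' g \<otimes>\<^bsub>E\<^esub> inv\<^bsub>E\<^esub> w g) = \<one>\<^bsub>A\<^esub>" if [simp]: "g \<in> carrier G" for g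
  proof -
    have "p (w g) = p (u' g)"
      using a Z1_closed[OF f u, of g]
      by (simp add: w_def p_act pe lift_proj[OF f u] lift_proj[OF f' u'] f'_eq A.M.m_ac)
    then show ?thesis
      by simp
  qed
  then have diff: "u' g \<otimes>\<^bsub>E\<^esub> inv\<^bsub>E\<^esub> w g \<in> i ` carrier M" if "g \<in> carrier G" for g
    using that by (simp add: i_image kernel_def)
  define m where "m g = inv_into (carrier M) i (u' g \<otimes>\<^bsub>E\<^esub> inv\<^bsub>E\<^esub> w g)" for g
  have m [simp]: "m g \<in> carrier M" if "g \<in> carrier G" for g
    unfolding m_def using that by (intro inv_into_into diff)
  have i_m: "i (m g) = u' g \<otimes>\<^bsub>E\<^esub> inv\<^bsub>E\<^esub> w g" if "g \<in> carrier G" for g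
    unfolding m_def using that by (intro f_inv_into_f diff)
  have u'_eq: "u' g = i (m g) \<otimes>\<^bsub>E\<^esub> u g \<otimes>\<^bsub>E\<^esub> (act E g e \<otimes>\<^bsub>E\<^esub> inv\<^bsub>E\<^esub> e)"
    if [simp]: "g \<in> carrier G" for g
  proof -
    have "u' g = i (m g) \<otimes>\<^bsub>E\<^esub> w g"
      by (simp add: i_m E.M.m_assoc)
    then show ?thesis
      by (simp add: w_def E.M.m_assoc)
  qed
  show ?thesis
  proof (rule M.H2_class_eqI[OF lift_cocycle_C2[OF f u] lift_cocycle_C2[OF f' u']])
    show "m \<in> carrier G \<rightarrow> carrier M" by simp
    fix g h assume [simp]: "g \<in> carrier G" "h \<in> carrier G"
    show "lift_cocycle u' (g, h) =
      act M g (m h) \<otimes>\<^bsub>M\<^esub> inv\<^bsub>M\<^esub> m (g \<otimes>\<^bsub>G\<^esub> h) \<otimes>\<^bsub>M\<^esub> m g \<otimes>\<^bsub>M\<^esub> lift_cocycle u (g, h)"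
    proof (rule inj_onD[OF i_inj])
      have "i (lift_cocycle u' (g, h)) = u' g \<otimes>\<^bsub>E\<^esub> act E g (u' h) \<otimes>\<^bsub>E\<^esub> inv\<^bsub>E\<^esub> u' (g \<otimes>\<^bsub>G\<^esub> h)"
        by (simp add: i_lift_cocycle[OF f' u'])
      also have "\<dots> = (i (m g) \<otimes>\<^bsub>E\<^esub> u g \<otimes>\<^bsub>E\<^esub> (act E g e \<otimes>\<^bsub>E\<^esub> inv\<^bsub>E\<^esub> e))
        \<otimes>\<^bsub>E\<^esub> (act E g (i (m h)) \<otimes>\<^bsub>E\<^esub> act E g (u h)
          \<otimes>\<^bsub>E\<^esub> (act E (g \<otimes>\<^bsub>G\<^esub> h) e \<otimes>\<^bsub>E\<^esub> inv\<^bsub>E\<^esub> act E g e))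
        \<otimes>\<^bsub>E\<^esub> inv\<^bsub>E\<^esub> (i (m (g \<otimes>\<^bsub>G\<^esub> h)) \<otimes>\<^bsub>E\<^esub> u (g \<otimes>\<^bsub>G\<^esub> h)
          \<otimes>\<^bsub>E\<^esub> (act E (g \<otimes>\<^bsub>G\<^esub> h) e \<otimes>\<^bsub>E\<^esub> inv\<^bsub>E\<^esub> e))"
        by (simp add: u'_eq E.act_add E.act_inv E.act_mult)
      also have "\<dots> = act E g (i (m h)) \<otimes>\<^bsub>E\<^esub> inv\<^bsub>E\<^esub> i (m (g \<otimes>\<^bsub>G\<^esub> h)) \<otimes>\<^bsub>E\<^esub> i (m g)
        \<otimes>\<^bsub>E\<^esub> (u g \<otimes>\<^bsub>E\<^esub> act E g (u h) \<otimes>\<^bsub>E\<^esub> inv\<^bsub>E\<^esub> u (g \<otimes>\<^bsub>G\<^esub> h))"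
        by (rule E.M.cocycle_shift) simp_all
      also have "\<dots> = i (act M g (m h) \<otimes>\<^bsub>M\<^esub> inv\<^bsub>M\<^esub> m (g \<otimes>\<^bsub>G\<^esub> h) \<otimes>\<^bsub>M\<^esub> m g
        \<otimes>\<^bsub>M\<^esub> lift_cocycle u (g, h))"
        by (simp add: i_lift_cocycle[OF f u] i_act)
      finally show "i (lift_cocycle u' (g, h)) = i (act M g (m h) \<otimes>\<^bsub>M\<^esub> inv\<^bsub>M\<^esub> m (g \<otimes>\<^bsub>G\<^esub> h)
        \<otimes>\<^bsub>M\<^esub> m g \<otimes>\<^bsub>M\<^esub> lift_cocycle u (g, h))" .
    qed simp_all
  qed
qed


section \<open>Independence of choices: the unions are single classes\<close>

lemma splice_class_eq:
  assumes f: "f \<in> Z1 G A" and f': "f' \<in> H1_class G A f"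
    and s: "s \<in> set_sections p (carrier E) (carrier A)"
    and s': "s' \<in> set_sections p (carrier E) (carrier A)"
  shows "H2_class G M (splice_cocycle G M E i s' f') = H2_class G M (splice_cocycle G M E i s f)"
  unfolding splice_cocycle_eq
proof (rule lift_cocycle_class_eq[symmetric, OF f _ f'])
  show f'_Z1: "f' \<in> Z1 G A"
    using A.H1_class_subset_Z1[OF f] f' by blast
  show "s \<circ> f \<in> lifts f" "s' \<circ> f' \<in> lifts f'"
    by (rule section_lift[OF s f] section_lift[OF s' f'_Z1])+
qed

text \<open>All cosets in the union agree and both index sets are inhabited, so the union is that
  one coset.\<close>

lemma connecting_hom_eq:
  assumes f: "f \<in> Z1 G A" and s: "s \<in> set_sections p (carrier E) (carrier A)"
  shows "connecting_hom G A M (E, i, p) (H1_class G A f)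
    = H2_class G M (splice_cocycle G M E i s f)"
proof -
  have "connecting_hom G A M (E, i, p) (H1_class G A f)
    = (\<Union>f'\<in>H1_class G A f. \<Union>s'\<in>set_sections p (carrier E) (carrier A).
        H2_class G M (splice_cocycle G M E i s f))"
    unfolding connecting_hom_def prod.case
    by (intro SUP_cong refl splice_class_eq f s)
  then show ?thesis
    using A.H1_class_self[OF f] s by auto
qed

lemma self_in_Ext1_class: "(E, i, p) \<in> Ext1_class G A M (E, i, p)"
proof -
  have "id \<in> gmod_iso G E E"
    by (auto simp: gmod_iso_def gmod_hom_def iso_def hom_def)
  then show ?thesis
    unfolding Ext1_class_def yoneda_equiv_def using ext by (auto intro!: bexI[of _ id])
qed

lemma Ext1_class_in_Ext1: "Ext1_class G A M (E, i, p) \<in> Ext1 G A M"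
  unfolding Ext1_class_def Ext1_def by (rule quotientI[OF ext])

text \<open>An isomorphism \<open>F\<close> compatible with the maps from \<open>M\<close> and to
  \<open>A\<close> carries a section \<open>s\<close> to \<open>F \<circ> s\<close>. Because
  \<open>F (i m) = i' m\<close>, the two 2-cocycles are equal as functions, not merely
  cohomologous.\<close>

lemma connecting_hom_Yoneda:
  assumes X: "X \<in> Ext1_class G A M (E, i, p)" and f: "f \<in> Z1 G A"
  shows "connecting_hom G A M X (H1_class G A f)
    = connecting_hom G A M (E, i, p) (H1_class G A f)"
proof -
  obtain E' i' p' F where X_eq: "X = (E', i', p')"
    and ext': "(E', i', p') \<in> gmod_extensions G A M" and F: "F \<in> gmod_iso G E E'"
    and Fi: "\<And>m. m \<in> carrier M \<Longrightarrow> F (i m) = i' m"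
    and pF: "\<And>e. e \<in> carrier E \<Longrightarrow> p' (F e) = p e"
    using X by (cases X) (auto simp: Ext1_class_def yoneda_equiv_def)
  interpret X: gmod_extension G A M E' i' p'
    by unfold_locales (rule ext')
  have F_hom: "F \<in> gmod_hom G E E'"
    using F by (simp add: gmod_iso_def)
  interpret F: group_hom E E' F
    using gmod_homD(1)[OF F_hom]
    by (simp add: group_hom_def group_hom_axioms_def E.M.is_group X.E.M.is_group)
  obtain s where s: "s \<in> set_sections p (carrier E) (carrier A)"
    using set_sections_nonempty[OF p_surj] by blast
  have s': "F \<circ> s \<in> set_sections p' (carrier E') (carrier A)"
    using s by (auto simp: set_sections_def pF Pi_iff)
  note u = section_lift[OF s f]
  have "splice_cocycle G M E' i' (F \<circ> s) f = splice_cocycle G M E i s f"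
    unfolding splice_cocycle_eq X.splice_cocycle_eq
  proof (rule extensionalityI[of _ "carrier G \<times> carrier G"])
    show "X.lift_cocycle (F \<circ> s \<circ> f) \<in> extensional (carrier G \<times> carrier G)"
      "lift_cocycle (s \<circ> f) \<in> extensional (carrier G \<times> carrier G)"
      by (simp_all add: lift_cocycle_def X.lift_cocycle_def)
    fix x assume "x \<in> carrier G \<times> carrier G"
    then obtain g h where x: "x = (g, h)" and [simp]: "g \<in> carrier G" "h \<in> carrier G"
      by blast
    note [simp] = lift_closed[OF f u, unfolded o_def]
    have "i' (lift_cocycle (s \<circ> f) (g, h)) = F (i (lift_cocycle (s \<circ> f) (g, h)))"
      by (simp add: Fi lift_cocycle_closed[OF f u])
    also have "\<dots> = i' (X.lift_cocycle (F \<circ> s \<circ> f) (g, h))"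
      by (simp add: i_lift_cocycle[OF f u] X.i_lift_cocycle[OF f X.section_lift[OF s' f]]
          gmod_homD(2)[OF F_hom])
    finally show "X.lift_cocycle (F \<circ> s \<circ> f) x = lift_cocycle (s \<circ> f) x"
      unfolding x
      by (rule inj_onD[OF X.i_inj, OF sym])
        (simp_all add: lift_cocycle_closed[OF f u] X.lift_cocycle_closed[OF f X.section_lift[OF s' f]])
  qed
  then show ?thesis
    unfolding X_eq connecting_hom_eq[OF f s] X.connecting_hom_eq[OF f s'] by simp
qed

lemma yoneda_splice_eq:
  assumes f: "f \<in> Z1 G A" and s: "s \<in> set_sections p (carrier E) (carrier A)"
  shows "yoneda_splice G A M (Ext1_class G A M (E, i, p)) (H1_class G A f)
    = H2_class G M (splice_cocycle G M E i s f)"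
proof -
  have "yoneda_splice G A M (Ext1_class G A M (E, i, p)) (H1_class G A f)
    = (\<Union>X\<in>Ext1_class G A M (E, i, p). H2_class G M (splice_cocycle G M E i s f))"
    unfolding yoneda_splice_def
    by (intro SUP_cong refl) (simp add: connecting_hom_Yoneda[OF _ f] connecting_hom_eq[OF f s])
  then show ?thesis
    using self_in_Ext1_class by auto
qed

text \<open>Under the union convention, membership here is precisely the well-definedness of the
  splice.\<close>

lemma yoneda_splice_in_H2:
  assumes f: "f \<in> Z1 G A"
  shows "yoneda_splice G A M (Ext1_class G A M (E, i, p)) (H1_class G A f) \<in> carrier (H2 G M)"
proof -
  obtain s where s: "s \<in> set_sections p (carrier E) (carrier A)"
    using set_sections_nonempty[OF p_surj] by blast
  show ?thesis
    unfolding yoneda_splice_eq[OF f s] splice_cocycle_eq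
    by (intro M.H2_class_in_carrier lift_cocycle_Z2[OF f] section_lift s f)
qed

end

section \<open>Permutation modules and groups of I-type\<close>

lemma (in gmodule) submodule:
  assumes N: "subgroup N M"
    and act_N: "\<And>g m. \<lbrakk>g \<in> carrier G; m \<in> N\<rbrakk> \<Longrightarrow> act M g m \<in> N"
  shows "gmodule G (M\<lparr>carrier := N\<rparr>)"
proof -
  interpret N: subgroup N M by (rule N)
  have "comm_group (M\<lparr>carrier := N\<rparr>)"
    by (rule group.group_comm_groupI[OF M.subgroup_imp_group[OF N]]) (auto intro: M.m_comm)
  then show ?thesis
    by (intro gmodule.intro gmodule_axioms.intro M.is_group G.is_group)
      (auto simp: hom_def act_add act_one act_mult act_N)
qed

lemma (in gmodule) gmod_hom_kernel:
  assumes A: "gmodule G A" and \<theta>: "\<theta> \<in> gmod_hom G M A"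
  shows "group_hom M A \<theta>" and "gmodule G (M\<lparr>carrier := kernel M A \<theta>\<rparr>)"
proof -
  interpret A: gmodule G A by (rule A)
  show hom: "group_hom M A \<theta>"
    using gmod_homD(1)[OF \<theta>] by (simp add: group_hom_def group_hom_axioms_def M.is_group A.M.is_group)
  show "gmodule G (M\<lparr>carrier := kernel M A \<theta>\<rparr>)"
    by (rule submodule[OF group_hom.subgroup_kernel[OF hom]])
      (auto simp: kernel_def gmod_homD(2)[OF \<theta>] A.act_zero)
qed

lemma kernel_extension:
  fixes A :: "('g, 'a) gmod" and E :: "('g, 'm) gmod"
  assumes "gmodule G E" "gmodule G A" and \<theta>: "\<theta> \<in> gmod_hom G E A" and surj: "\<theta> ` carrier E = carrier A"
  shows "gmod_extension G A (E\<lparr>carrier := kernel E A \<theta>\<rparr>) E id \<theta>"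
proof -
  have "id \<in> gmod_hom G (E\<lparr>carrier := kernel E A \<theta>\<rparr>) E"
    by (auto simp: gmod_hom_def hom_def kernel_def)
  then show ?thesis
    using assms gmodule.gmod_hom_kernel(2)[OF assms(1-3)] gmod_homD(1)[OF \<theta>]
    by (simp add: gmod_extension_def gmod_extensions_def mon_def epi_def gmod_hom_def)
qed

lemma (in gmodule) quotient_kernel_iso:
  assumes A: "gmodule G A" and \<theta>: "\<theta> \<in> gmod_hom G M A" and surj: "\<theta> ` carrier M = carrier A"
  shows "\<exists>f\<in>gmod_iso G (quotient_gmod M (kernel M A \<theta>)) A.
    \<forall>m\<in>carrier M. f (kernel M A \<theta> #>\<^bsub>M\<^esub> m) = \<theta> m"
proof -
  interpret A: gmodule G A by (rule A)
  interpret \<theta>: group_hom M A \<theta> by (rule gmod_hom_kernel(1)[OF A \<theta>])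
  \<comment> \<open>The same formula as in the first isomorphism theorem for groups, which therefore
    applies directly; only equivariance remains.\<close>
  define f where "f X = the_elem (\<theta> ` X)" for X
  have coset_image: "\<theta> ` (kernel M A \<theta> #>\<^bsub>M\<^esub> m) = {\<theta> m}" if "m \<in> carrier M" for m
    using that by (force simp: r_coset_def kernel_def)
  have f_coset: "f (kernel M A \<theta> #>\<^bsub>M\<^esub> m) = \<theta> m" if "m \<in> carrier M" for m
    using coset_image[OF that] by (simp add: f_def)
  have f_act: "f (act M g ` C) = act A g (f C)"
    if g: "g \<in> carrier G" and C: "C \<in> carrier (M Mod kernel M A \<theta>)" for g C
  proof -
    obtain m where m: "m \<in> carrier M" and C_eq: "C = kernel M A \<theta> #>\<^bsub>M\<^esub> m"
      using C by (auto simp: FactGroup_def RCOSETS_def)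
    have "C \<subseteq> carrier M"
      using m by (auto simp: C_eq r_coset_def kernel_def)
    then have "\<theta> ` act M g ` C = act A g ` \<theta> ` C"
      using g by (force simp: image_image gmod_homD(2)[OF \<theta>])
    then show ?thesis
      using m by (simp add: f_def C_eq coset_image)
  qed
  have "f \<in> iso (M Mod kernel M A \<theta>) A"
    unfolding f_def by (rule \<theta>.FactGroup_iso_set[OF surj])
  then have "f \<in> gmod_iso G (quotient_gmod M (kernel M A \<theta>)) A"
    by (simp add: gmod_iso_def gmod_hom_def iso_def hom_def quotient_gmod_def f_act)
  then show ?thesis
    using f_coset by blast
qed

lemma (in gmodule) semidirect_group: "group (semidirect M G (act M))"
proof (rule groupI)
  fix x assume "x \<in> carrier (semidirect M G (act M))"
  then obtain m g where x: "x = (m, g)" and mg: "m \<in> carrier M" "g \<in> carrier G"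
    by (auto simp: semidirect_def)
  show "\<exists>y\<in>carrier (semidirect M G (act M)).
      y \<otimes>\<^bsub>semidirect M G (act M)\<^esub> x = \<one>\<^bsub>semidirect M G (act M)\<^esub>"
    by (rule bexI[of _ "(act M (inv\<^bsub>G\<^esub> g) (inv\<^bsub>M\<^esub> m), inv\<^bsub>G\<^esub> g)"])
      (use mg in \<open>simp_all add: x semidirect_def act_inv\<close>)
qed (auto simp: semidirect_def act_add act_mult act_one M.m_assoc G.m_assoc)

section \<open>Permutation modules and the ambient semidirect product\<close>

lemma perm_module_sel [simp]:
  "carrier (perm_module n \<rho>) = carrier (Zn n)"
  "monoid.mult (perm_module n \<rho>) = monoid.mult (Zn n)"
  "one (perm_module n \<rho>) = one (Zn n)"
  "act (perm_module n \<rho>) g = perm_act n (\<rho> g)"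
  by (simp_all add: perm_module_def)

lemma perm_module_comm_group: "comm_group (perm_module n \<rho>)"
proof (rule comm_groupI)
  fix t assume t: "t \<in> carrier (perm_module n \<rho>)"
  show "\<exists>u\<in>carrier (perm_module n \<rho>). u \<otimes>\<^bsub>perm_module n \<rho>\<^esub> t = \<one>\<^bsub>perm_module n \<rho>\<^esub>"
    by (rule bexI[of _ "\<lambda>i\<in>{1..n}. - t i"]) (auto simp: Zn_def)
qed (auto simp: Zn_def PiE_iff extensional_def fun_eq_iff)

lemma perm_module_gmodule:
  assumes "group H" and \<rho>: "\<rho> \<in> hom H (sym_group n)"
  shows "gmodule H (perm_module n \<rho>)"
proof -
  have perm: "\<rho> g permutes {1..n}" if "g \<in> carrier H" for g
    using \<rho> that by (auto simp: hom_def sym_group_def)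
  \<comment> \<open>\<open>perm_act\<close> restricts to \<open>{1..n}\<close>; composing two
    actions is harmless only because the inner argument stays in that range.\<close>
  have inv_perm: "inv' (\<rho> g) i \<in> {1..n} \<longleftrightarrow> i \<in> {1..n}" if "g \<in> carrier H" for g i
    by (rule permutes_in_image[OF permutes_inv[OF perm[OF that]]])
  have \<rho>_one: "\<rho> \<one>\<^bsub>H\<^esub> = id"
    using hom_one[OF \<rho> \<open>group H\<close> sym_group_is_group] by (simp add: sym_group_one)
  \<comment> \<open>Inversion reverses products and so does precomposition; together they give a
    left action.\<close>
  have \<rho>_mult: "inv' (\<rho> (g \<otimes>\<^bsub>H\<^esub> h)) = inv' (\<rho> h) \<circ> inv' (\<rho> g)"
    if "g \<in> carrier H" "h \<in> carrier H" for g h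
    using hom_mult[OF \<rho> that] that
    by (simp add: sym_group_mult o_inv_distrib permutes_bij[OF perm])
  interpret P: comm_group "perm_module n \<rho>" by (rule perm_module_comm_group)
  have "act (perm_module n \<rho>) g \<in> hom (perm_module n \<rho>) (perm_module n \<rho>)"
    if "g \<in> carrier H" for g
    using inv_perm[OF that] by (auto simp: hom_def Zn_def perm_act_def fun_eq_iff)
  moreover have "act (perm_module n \<rho>) \<one>\<^bsub>H\<^esub> m = m" if "m \<in> carrier (perm_module n \<rho>)" for m
    using that by (auto simp: Zn_def perm_act_def \<rho>_one fun_eq_iff PiE_iff extensional_def)
  moreover have "act (perm_module n \<rho>) (g \<otimes>\<^bsub>H\<^esub> h) m
      = act (perm_module n \<rho>) g (act (perm_module n \<rho>) h m)"
    if "g \<in> carrier H" "h \<in> carrier H" for g h m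
    using inv_perm[OF that(1)] by (auto simp: perm_act_def \<rho>_mult[OF that] fun_eq_iff)
  ultimately show ?thesis
    using \<open>group H\<close>
    by (intro gmodule.intro gmodule_axioms.intro P.comm_group_axioms) auto
qed

text \<open>With \<open>id\<close> in place of \<open>\<rho>\<close>, the symmetric group itself
  acts on Z^n, and the general semidirect product applies.\<close>

lemma ZnSn_group: "group (ZnSn n)"
proof -
  have "gmodule (sym_group n) (perm_module n id)"
    by (rule perm_module_gmodule[OF sym_group_is_group]) (auto simp: hom_def sym_group_def)
  then have "group (semidirect (perm_module n id) (sym_group n) (act (perm_module n id)))"
    by (rule gmodule.semidirect_group)
  then show ?thesis
    by (simp add: ZnSn_def semidirect_def perm_module_def)
qed

lemma ZnSn_mult: "(t, \<sigma>) \<otimes>\<^bsub>ZnSn n\<^esub> (u, \<tau>) = (t \<otimes>\<^bsub>Zn n\<^esub> perm_act n \<sigma> u, \<sigma> \<circ> \<tau>)"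
  by (simp add: ZnSn_def semidirect_def sym_group_mult)

lemma ZnSn_carrier: "carrier (ZnSn n) = carrier (Zn n) \<times> carrier (sym_group n)"
  by (simp add: ZnSn_def semidirect_def)

lemma ZnSn_one: "\<one>\<^bsub>ZnSn n\<^esub> = (\<one>\<^bsub>Zn n\<^esub>, id)"
  by (simp add: ZnSn_def semidirect_def sym_group_one)

section \<open>An I-datum on \<open>G0\<close> with a faithful permutation action\<close>

locale I_datum = A: gmodule G0 A
  for G0 :: "('g, 'b) monoid_scheme" and A :: "('g, 'a) gmod" +
  fixes \<pi>0 :: "'g \<Rightarrow> 'a" and n :: nat and \<rho> :: "'g \<Rightarrow> nat \<Rightarrow> nat"
  assumes \<pi>0_Z1: "\<pi>0 \<in> Z1 G0 A" and \<pi>0_bij: "bij_betw \<pi>0 (carrier G0) (carrier A)"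
    and \<rho>_mon: "\<rho> \<in> mon G0 (sym_group n)"
begin

abbreviation "P \<equiv> perm_module n \<rho>"

lemma \<rho>_hom: "\<rho> \<in> hom G0 (sym_group n)" and \<rho>_inj: "inj_on \<rho> (carrier G0)"
  using \<rho>_mon by (auto simp: mon_def)

sublocale P: gmodule G0 P
  by (rule perm_module_gmodule[OF A.G.is_group \<rho>_hom])

sublocale \<rho>: group_hom G0 "sym_group n" \<rho>
  by (simp add: group_hom_def group_hom_axioms_def A.G.is_group sym_group_is_group \<rho>_hom)

lemma \<rho>_one: "\<rho> \<one>\<^bsub>G0\<^esub> = id"
  using \<rho>.hom_one by (simp only: sym_group_one)

lemma \<rho>_mult: "\<lbrakk>x \<in> carrier G0; y \<in> carrier G0\<rbrakk> \<Longrightarrow> \<rho> (x \<otimes>\<^bsub>G0\<^esub> y) = \<rho> x \<circ> \<rho> y"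
  using hom_mult[OF \<rho>_hom] by (simp only: sym_group_mult)

lemma \<pi>0_closed [simp]: "x \<in> carrier G0 \<Longrightarrow> \<pi>0 x \<in> carrier A"
  using A.Z1_subset \<pi>0_Z1 by auto

lemma \<pi>0_mult:
  "\<lbrakk>x \<in> carrier G0; y \<in> carrier G0\<rbrakk> \<Longrightarrow> \<pi>0 (x \<otimes>\<^bsub>G0\<^esub> y) = \<pi>0 x \<otimes>\<^bsub>A\<^esub> act A x (\<pi>0 y)"
  using \<pi>0_Z1 by (simp add: Z1_def)

lemma \<pi>0_one: "\<pi>0 \<one>\<^bsub>G0\<^esub> = \<one>\<^bsub>A\<^esub>"
  using \<pi>0_mult[of "\<one>\<^bsub>G0\<^esub>" "\<one>\<^bsub>G0\<^esub>"] by (simp add: A.act_one A.M.l_cancel_one')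

text \<open>The cocycle identity for \<open>inv x\<close> times \<open>x\<close>. The formula
  matches the first component of an inverse in the semidirect product, which closes
  \<open>I_group\<close> under inverses.\<close>

lemma \<pi>0_inv:
  assumes [simp]: "x \<in> carrier G0"
  shows "\<pi>0 (inv\<^bsub>G0\<^esub> x) = act A (inv\<^bsub>G0\<^esub> x) (inv\<^bsub>A\<^esub> \<pi>0 x)"
proof -
  have "\<pi>0 (inv\<^bsub>G0\<^esub> x) \<otimes>\<^bsub>A\<^esub> act A (inv\<^bsub>G0\<^esub> x) (\<pi>0 x) = \<one>\<^bsub>A\<^esub>"
    using \<pi>0_mult[of "inv\<^bsub>G0\<^esub> x" x] by (simp add: \<pi>0_one)
  then show ?thesis
    using A.M.inv_equality[of "\<pi>0 (inv\<^bsub>G0\<^esub> x)" "act A (inv\<^bsub>G0\<^esub> x) (\<pi>0 x)"] by (simp add: A.act_inv)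
qed

lemma \<pi>0_eq_iff: "\<lbrakk>x \<in> carrier G0; y \<in> carrier G0\<rbrakk> \<Longrightarrow> \<pi>0 x = \<pi>0 y \<longleftrightarrow> x = y"
  using \<pi>0_bij by (auto simp: bij_betw_def inj_on_eq_iff)

lemma \<pi>0_surj: "a \<in> carrier A \<Longrightarrow> \<exists>x\<in>carrier G0. \<pi>0 x = a"
  using \<pi>0_bij unfolding bij_betw_def by (metis imageE)

lemma to_G0_\<rho>: "x \<in> carrier G0 \<Longrightarrow> to_G0 G0 \<rho> (t, \<rho> x) = x"
  by (simp add: to_G0_def inv_into_f_f[OF \<rho>_inj])

lemma ZnSn_mult_\<rho>:
  "\<lbrakk>x \<in> carrier G0; y \<in> carrier G0\<rbrakk>
    \<Longrightarrow> (t, \<rho> x) \<otimes>\<^bsub>ZnSn n\<^esub> (u, \<rho> y) = (t \<otimes>\<^bsub>P\<^esub> act P x u, \<rho> (x \<otimes>\<^bsub>G0\<^esub> y))"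
  by (simp add: ZnSn_mult sym_group_mult)

text \<open>The fibre product of \<open>\<theta>\<close> and \<open>\<pi>0\<close> over
  \<open>A\<close>, with its second factor embedded by \<open>\<rho>\<close>.\<close>

definition I_group :: "((nat \<Rightarrow> int) \<Rightarrow> 'a) \<Rightarrow> ((nat \<Rightarrow> int) \<times> (nat \<Rightarrow> nat)) set"
  where "I_group \<theta> = {(t, \<rho> x) | t x. t \<in> carrier P \<and> x \<in> carrier G0 \<and> \<theta> t = \<pi>0 x}"

definition cocycle_map :: "((nat \<Rightarrow> int) \<times> (nat \<Rightarrow> nat)) set \<Rightarrow> (nat \<Rightarrow> int) \<Rightarrow> 'a"
  where "cocycle_map G = (\<lambda>t\<in>carrier P. \<pi>0 (to_G0 G0 \<rho> (inv_into G fst t)))"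

end

text \<open>Only the image in the symmetric group is prescribed, which is weaker than
  \<open>has_assoc_I_datum\<close>. Thus the locale also applies to \<open>I_group \<theta>\<close>
  before its associated I-datum is known.\<close>

locale I_type_over = I_datum G0 A \<pi>0 n \<rho>
  for G0 :: "('g, 'b) monoid_scheme" and A :: "('g, 'a) gmod" and \<pi>0 n \<rho> +
  fixes G :: "((nat \<Rightarrow> int) \<times> (nat \<Rightarrow> nat)) set"
  assumes I_type: "I_type n G" and snd_image: "snd ` G = \<rho> ` carrier G0"
begin

abbreviation "\<Gamma> \<equiv> (ZnSn n)\<lparr>carrier := G\<rparr>"
abbreviation "q \<equiv> to_G0 G0 \<rho>"

sublocale G: subgroup G "ZnSn n" using I_type by (simp add: I_type_def)
sublocale \<Gamma>: group \<Gamma> by (rule G.subgroup_is_group[OF ZnSn_group])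

lemma fst_bij: "bij_betw fst G (carrier P)"
  using I_type by (simp add: I_type_def)

lemma fst_inj: "inj_on fst G" and fst_image: "fst ` G = carrier P"
  using fst_bij by (auto simp: bij_betw_def)

lemma fst_closed: "g \<in> G \<Longrightarrow> fst g \<in> carrier P"
  using fst_image by blast

lemma fst_surjE:
  assumes "t \<in> carrier P"
  obtains g where "g \<in> G" and "t = fst g"
  using assms fst_image by (metis imageE)

lemma q_closed: "g \<in> G \<Longrightarrow> q g \<in> carrier G0"
  using snd_image by (auto simp: to_G0_def intro!: inv_into_into)

lemma \<rho>_q: "g \<in> G \<Longrightarrow> \<rho> (q g) = snd g"
  using snd_image by (auto simp: to_G0_def intro!: f_inv_into_f)

lemma
  assumes g: "g \<in> G" and h: "h \<in> G"
  shows fst_mult: "fst (g \<otimes>\<^bsub>ZnSn n\<^esub> h) = fst g \<otimes>\<^bsub>P\<^esub> act P (q g) (fst h)"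
    and q_mult: "q (g \<otimes>\<^bsub>ZnSn n\<^esub> h) = q g \<otimes>\<^bsub>G0\<^esub> q h"
proof -
  have "g = (fst g, \<rho> (q g))" "h = (fst h, \<rho> (q h))"
    using g h by (simp_all add: \<rho>_q)
  then have mult: "g \<otimes>\<^bsub>ZnSn n\<^esub> h = (fst g \<otimes>\<^bsub>P\<^esub> act P (q g) (fst h), \<rho> (q g \<otimes>\<^bsub>G0\<^esub> q h))"
    using ZnSn_mult_\<rho>[OF q_closed[OF g] q_closed[OF h]] by metis
  show "fst (g \<otimes>\<^bsub>ZnSn n\<^esub> h) = fst g \<otimes>\<^bsub>P\<^esub> act P (q g) (fst h)"
    by (simp add: mult)
  show "q (g \<otimes>\<^bsub>ZnSn n\<^esub> h) = q g \<otimes>\<^bsub>G0\<^esub> q h"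
    by (simp only: mult to_G0_\<rho> q_closed A.G.m_closed g h)
qed

lemma q_hom: "q \<in> hom \<Gamma> G0"
  by (auto simp: hom_def q_closed q_mult)

lemma q_image: "q ` G = carrier G0"
proof
  show "carrier G0 \<subseteq> q ` G"
  proof
    fix x assume x: "x \<in> carrier G0"
    then obtain g where g: "g \<in> G" and "snd g = \<rho> x"
      using snd_image by (metis imageE imageI)
    then have "q g = x"
      using x by (simp add: to_G0_def inv_into_f_f[OF \<rho>_inj])
    then show "x \<in> q ` G"
      using g by blast
  qed
qed (auto simp: q_closed)

lemma act_kernel_iff: "g \<in> act_kernel n G \<longleftrightarrow> g \<in> G \<and> q g = \<one>\<^bsub>G0\<^esub>"
proof -
  have "snd g = id \<longleftrightarrow> q g = \<one>\<^bsub>G0\<^esub>" if g: "g \<in> G" for g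
    using \<rho>_q[OF g] \<rho>_one inj_onD[OF \<rho>_inj, of "q g" "\<one>\<^bsub>G0\<^esub>"] q_closed[OF g] A.G.one_closed
    by metis
  then show ?thesis
    unfolding act_kernel_def sym_group_one mem_Collect_eq by blast
qed

lemma act_kernel_eq: "act_kernel n G = kernel \<Gamma> G0 q"
  by (auto simp: act_kernel_iff kernel_def)

lemma q_group_hom: "group_hom \<Gamma> G0 q"
  by (simp add: group_hom_def group_hom_axioms_def A.G.is_group \<Gamma>.is_group q_hom)

lemma act_kernel_subgroup: "subgroup (act_kernel n G) \<Gamma>"
  unfolding act_kernel_eq by (rule group_hom.subgroup_kernel[OF q_group_hom])

lemma act_kernel_subset: "act_kernel n G \<subseteq> G"
  by (auto simp: act_kernel_def)

text \<open>The left factor acts trivially, so the cocycle is additive here. This gives the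
  homomorphism on the kernel and also the comparison of cosets of the kernel in
  \<open>G\<close>.\<close>

lemma fst_mult_kernel:
  "\<lbrakk>k \<in> act_kernel n G; g \<in> G\<rbrakk> \<Longrightarrow> fst (k \<otimes>\<^bsub>ZnSn n\<^esub> g) = fst k \<otimes>\<^bsub>P\<^esub> fst g"
  using fst_mult[of k g] P.act_one[OF fst_closed[of g]] by (simp add: act_kernel_iff)

lemma act_kernel_group: "group ((ZnSn n)\<lparr>carrier := act_kernel n G\<rparr>)"
  using \<Gamma>.subgroup_imp_group[OF act_kernel_subgroup] by simp

lemma fst_kernel_hom: "fst \<in> hom ((ZnSn n)\<lparr>carrier := act_kernel n G\<rparr>) P"
  using fst_closed by (auto simp: hom_def fst_mult_kernel act_kernel_iff)

lemma fst_kernel_subgroup: "subgroup (fst ` act_kernel n G) P"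
proof -
  interpret fst: group_hom "(ZnSn n)\<lparr>carrier := act_kernel n G\<rparr>" P fst
    using act_kernel_group fst_kernel_hom P.M.is_group
    by (simp only: group_hom_def group_hom_axioms_def simp_thms)
  show ?thesis
    using fst.img_is_subgroup by simp
qed

lemma cocycle_map_fst: "g \<in> G \<Longrightarrow> cocycle_map G (fst g) = \<pi>0 (q g)"
  using fst_closed by (simp add: cocycle_map_def inv_into_f_f[OF fst_inj])

text \<open>For the harder inclusion, \<open>t\<close> comes from some \<open>h\<close> in
  \<open>G\<close>; injectivity of \<open>\<pi>0\<close> forces \<open>q h = x\<close>, and then
  \<open>h\<close> has the same two components as the given pair.\<close>

lemma I_group_cocycle_map: "I_group (cocycle_map G) = G"
proof (intro equalityI subsetI)
  fix g assume g: "g \<in> G"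
  then have "g = (fst g, \<rho> (q g))"
    by (simp add: \<rho>_q)
  then show "g \<in> I_group (cocycle_map G)"
    unfolding I_group_def using g fst_closed q_closed cocycle_map_fst by blast
next
  fix g assume "g \<in> I_group (cocycle_map G)"
  then obtain t x where g: "g = (t, \<rho> x)" and t: "t \<in> carrier P" and x: "x \<in> carrier G0"
    and eq: "cocycle_map G t = \<pi>0 x"
    unfolding I_group_def by blast
  obtain h where h: "h \<in> G" and fst_h: "t = fst h"
    using t by (rule fst_surjE)
  then have "q h = x"
    using eq x by (simp add: cocycle_map_fst q_closed \<pi>0_eq_iff)
  then have "g = h"
    using \<rho>_q[OF h] by (simp add: g fst_h)
  then show "g \<in> G"
    using h by simp
qed

text \<open>
  Additivity is what the isomorphism of the associated I-datum provides; equivariance then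
  follows from the two cocycle identities, because \<open>q\<close> is onto.
\<close>
lemma cocycle_map_perm_ext:
  assumes "has_assoc_I_datum n G G0 \<rho> A \<pi>0"
  shows "cocycle_map G \<in> perm_ext_maps n G0 \<rho> A"
proof -
  define L where "L = fst ` act_kernel n G"
  obtain f where f: "f \<in> gmod_iso G0 (quotient_gmod P L) A"
    and f_fst: "\<And>g. g \<in> G \<Longrightarrow> f (L #>\<^bsub>Zn n\<^esub> fst g) = \<pi>0 (q g)"
    using assms unfolding has_assoc_I_datum_def L_def by blast
  have coset: "L #>\<^bsub>Zn n\<^esub> t = L #>\<^bsub>P\<^esub> t" for t
    by (simp add: r_coset_def)
  \<comment> \<open>The map is now the projection modulo \<open>L\<close> followed by
    \<open>f\<close>; both are homomorphisms, whence additivity.\<close>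
  have map_eq: "cocycle_map G t = f (L #>\<^bsub>P\<^esub> t)" if "t \<in> carrier P" for t
  proof -
    obtain g where "g \<in> G" "t = fst g"
      using \<open>t \<in> carrier P\<close> by (rule fst_surjE)
    then show ?thesis
      using f_fst[of g] by (simp add: cocycle_map_fst coset)
  qed
  have "L \<lhd> P"
    unfolding L_def by (simp add: P.M.normal_iff_subgroup fst_kernel_subgroup)
  then interpret L: normal L P .
  have f_add: "f (C <#>\<^bsub>P\<^esub> D) = f C \<otimes>\<^bsub>A\<^esub> f D" if "C \<in> rcosets\<^bsub>P\<^esub> L" "D \<in> rcosets\<^bsub>P\<^esub> L" for C D
    using f that by (auto simp: gmod_iso_def gmod_hom_def hom_def quotient_gmod_def FactGroup_def)
  have add: "cocycle_map G (t \<otimes>\<^bsub>P\<^esub> u) = cocycle_map G t \<otimes>\<^bsub>A\<^esub> cocycle_map G u"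
    if "t \<in> carrier P" "u \<in> carrier P" for t u
  proof -
    have "L #>\<^bsub>P\<^esub> t \<in> rcosets\<^bsub>P\<^esub> L" "L #>\<^bsub>P\<^esub> u \<in> rcosets\<^bsub>P\<^esub> L"
      using that by (auto simp: RCOSETS_def)
    then have "f ((L #>\<^bsub>P\<^esub> t) <#>\<^bsub>P\<^esub> (L #>\<^bsub>P\<^esub> u)) = f (L #>\<^bsub>P\<^esub> t) \<otimes>\<^bsub>A\<^esub> f (L #>\<^bsub>P\<^esub> u)"
      by (rule f_add)
    then show ?thesis
      unfolding L.rcos_sum[OF that]
      by (simp only: map_eq[OF that(1)] map_eq[OF that(2)] map_eq[OF P.M.m_closed[OF that]])
  qed
  have closed: "cocycle_map G t \<in> carrier A" if "t \<in> carrier P" for t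
  proof -
    obtain g where "g \<in> G" "t = fst g"
      using \<open>t \<in> carrier P\<close> by (rule fst_surjE)
    then show ?thesis
      by (simp add: cocycle_map_fst q_closed)
  qed
  have equivariant: "cocycle_map G (act P x t) = act A x (cocycle_map G t)"
    if x: "x \<in> carrier G0" and t: "t \<in> carrier P" for x t
  proof -
    obtain g where g: "g \<in> G" and tg: "t = fst g"
      using t by (rule fst_surjE)
    obtain h where h: "h \<in> G" and xh: "x = q h"
      using x q_image by (metis imageE)
    have "cocycle_map G (fst h) \<otimes>\<^bsub>A\<^esub> cocycle_map G (act P x t)
        = cocycle_map G (fst (h \<otimes>\<^bsub>ZnSn n\<^esub> g))"
      using x t h by (simp only: fst_mult[OF h g] tg xh add fst_closed P.act_closed)
    also have "\<dots> = \<pi>0 (q h \<otimes>\<^bsub>G0\<^esub> q g)"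
      using g h by (simp add: cocycle_map_fst q_mult)
    also have "\<dots> = cocycle_map G (fst h) \<otimes>\<^bsub>A\<^esub> act A x (cocycle_map G t)"
      using g h by (simp add: \<pi>0_mult q_closed cocycle_map_fst tg xh)
    finally show ?thesis
      by (rule A.M.Units_l_cancel[unfolded A.M.Units_eq, THEN iffD1, rotated -1])
        (use x t h in \<open>simp_all only: closed fst_closed P.act_closed A.act_closed\<close>)
  qed
  have "cocycle_map G ` carrier P = \<pi>0 ` q ` G"
    unfolding fst_image[symmetric] image_image by (simp add: cocycle_map_fst)
  also have "\<dots> = carrier A"
    using \<pi>0_bij by (simp add: q_image bij_betw_def)
  finally have "cocycle_map G ` carrier P = carrier A" .
  moreover have "cocycle_map G \<in> gmod_hom G0 P A"
    using add closed equivariant by (auto simp: gmod_hom_def hom_def)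
  moreover have "cocycle_map G \<in> extensional (carrier P)"
    by (simp add: cocycle_map_def)
  ultimately show ?thesis
    by (simp add: perm_ext_maps_def)
qed

end

section \<open>The correspondence\<close>

context I_datum
begin

lemma kernel_P: "kernel (Zn n) A \<theta> = kernel P A \<theta>"
  by (simp add: kernel_def)

lemma ker_module_eq: "ker_module n \<rho> A \<theta> = P\<lparr>carrier := kernel P A \<theta>\<rparr>"
  by (simp add: ker_module_def kernel_P)

lemma perm_ext_mapsD:
  assumes "\<theta> \<in> perm_ext_maps n G0 \<rho> A"
  shows "\<theta> \<in> gmod_hom G0 P A" and "\<theta> ` carrier P = carrier A"
    and "\<theta> \<in> extensional (carrier P)"
  using assms by (auto simp: perm_ext_maps_def)

lemma perm_ext_map_gmod_extension:
  assumes "\<theta> \<in> perm_ext_maps n G0 \<rho> A"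
  shows "gmod_extension G0 A (ker_module n \<rho> A \<theta>) P id \<theta>"
  unfolding ker_module_eq
  by (rule kernel_extension[OF P.gmodule_axioms A.gmodule_axioms perm_ext_mapsD(1,2)[OF assms]])

lemma I_group_memI:
  "\<lbrakk>t \<in> carrier P; x \<in> carrier G0; \<theta> t = \<pi>0 x\<rbrakk> \<Longrightarrow> (t, \<rho> x) \<in> I_group \<theta>"
  unfolding I_group_def by blast

lemma I_group_memE:
  assumes "g \<in> I_group \<theta>"
  obtains t x where "g = (t, \<rho> x)" "t \<in> carrier P" "x \<in> carrier G0" "\<theta> t = \<pi>0 x"
  using assms unfolding I_group_def by blast

lemma I_group_subgroup:
  assumes "\<theta> \<in> perm_ext_maps n G0 \<rho> A"
  shows "subgroup (I_group \<theta>) (ZnSn n)"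
proof -
  note hom = perm_ext_mapsD(1)[OF assms]
  interpret \<theta>: group_hom P A \<theta>
    by (rule P.gmod_hom_kernel(1)[OF A.gmodule_axioms hom])
  have \<theta>_act: "\<theta> (act P x t) = act A x (\<theta> t)" if "x \<in> carrier G0" "t \<in> carrier P" for x t
    using gmod_homD(2)[OF hom that] .
  show ?thesis
  proof (rule group.subgroupI[OF ZnSn_group])
    show "I_group \<theta> \<subseteq> carrier (ZnSn n)"
      using \<rho>.hom_closed by (auto simp: ZnSn_carrier elim!: I_group_memE)
    have "(\<one>\<^bsub>P\<^esub>, \<rho> \<one>\<^bsub>G0\<^esub>) \<in> I_group \<theta>"
      by (rule I_group_memI[OF P.M.one_closed A.G.one_closed]) (simp only: \<theta>.hom_one \<pi>0_one)
    then show "I_group \<theta> \<noteq> {}" by blast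
  next
    fix g assume "g \<in> I_group \<theta>"
    then obtain t x where g: "g = (t, \<rho> x)" and t: "t \<in> carrier P" and x: "x \<in> carrier G0"
      and tx: "\<theta> t = \<pi>0 x"
      by (rule I_group_memE)
    \<comment> \<open>The inverse in a semidirect product; \<open>\<theta>\<close> takes its first
      component to \<open>\<pi>0 (inv x)\<close> by equivariance and
      \<open>\<pi>0_inv\<close>.\<close>
    let ?h = "(act P (inv\<^bsub>G0\<^esub> x) (inv\<^bsub>P\<^esub> t), \<rho> (inv\<^bsub>G0\<^esub> x))"
    have "?h \<otimes>\<^bsub>ZnSn n\<^esub> g = \<one>\<^bsub>ZnSn n\<^esub>"
      unfolding g ZnSn_mult_\<rho>[OF A.G.inv_closed[OF x] x]
      using t x P.M.l_inv[of "act P (inv\<^bsub>G0\<^esub> x) t"] P.act_closed[of "inv\<^bsub>G0\<^esub> x" t]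
        P.act_inv[of "inv\<^bsub>G0\<^esub> x" t]
      by (simp add: ZnSn_one \<rho>_one del: \<rho>.hom_one)
    moreover have "?h \<in> carrier P \<times> carrier (sym_group n)" "g \<in> carrier P \<times> carrier (sym_group n)"
      unfolding g
      by (intro SigmaI P.act_closed \<rho>.hom_closed A.G.inv_closed P.M.inv_closed t x)+
    ultimately have "inv\<^bsub>ZnSn n\<^esub> g = ?h"
      by (intro group.inv_equality[OF ZnSn_group]) (simp_all only: ZnSn_carrier perm_module_sel)
    moreover have "?h \<in> I_group \<theta>"
      using t x P.M.inv_closed[OF t]
      by (intro I_group_memI P.act_closed A.G.inv_closed)
        (simp_all only: \<theta>_act A.G.inv_closed \<theta>.hom_inv tx \<pi>0_inv)
    ultimately show "inv\<^bsub>ZnSn n\<^esub> g \<in> I_group \<theta>" by (simp only:)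
  next
    fix g h assume "g \<in> I_group \<theta>" "h \<in> I_group \<theta>"
    then obtain t x u y where g: "g = (t, \<rho> x)" and t: "t \<in> carrier P" and x: "x \<in> carrier G0"
      and tx: "\<theta> t = \<pi>0 x" and h: "h = (u, \<rho> y)" and u: "u \<in> carrier P"
      and y: "y \<in> carrier G0" and uy: "\<theta> u = \<pi>0 y"
      by (elim I_group_memE)
    show "g \<otimes>\<^bsub>ZnSn n\<^esub> h \<in> I_group \<theta>"
      unfolding g h ZnSn_mult_\<rho>[OF x y]
      using t x u y
      by (intro I_group_memI P.M.m_closed P.act_closed A.G.m_closed)
        (simp_all only: \<theta>_act \<theta>.hom_mult P.act_closed tx uy \<pi>0_mult)
  qed
qed

text \<open>Injectivity of \<open>fst\<close> is injectivity of \<open>\<pi>0\<close>, and its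
  surjectivity is surjectivity of \<open>\<pi>0\<close>. Surjectivity of \<open>\<theta>\<close>
  gives every \<open>\<rho> x\<close> as a second component.\<close>

lemma I_group_I_type_over:
  assumes "\<theta> \<in> perm_ext_maps n G0 \<rho> A"
  shows "I_type_over G0 A \<pi>0 n \<rho> (I_group \<theta>)"
proof
  note surj = perm_ext_mapsD(2)[OF assms]
  have "inj_on fst (I_group \<theta>)"
    by (auto simp: inj_on_def \<pi>0_eq_iff elim!: I_group_memE)
  moreover have "fst ` I_group \<theta> = carrier P"
  proof
    show "carrier P \<subseteq> fst ` I_group \<theta>"
    proof
      fix t assume t: "t \<in> carrier P"
      then obtain x where "x \<in> carrier G0" "\<theta> t = \<pi>0 x"
        using \<pi>0_surj surj by (metis imageI)
      then show "t \<in> fst ` I_group \<theta>"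
        using I_group_memI[OF t] by (intro image_eqI[of _ _ "(t, \<rho> x)"]) auto
    qed
  qed (auto elim!: I_group_memE)
  ultimately show "I_type n (I_group \<theta>)"
    using I_group_subgroup[OF assms] by (simp add: I_type_def bij_betw_def)
  have "\<rho> x \<in> snd ` I_group \<theta>" if x: "x \<in> carrier G0" for x
  proof -
    obtain t where "t \<in> carrier P" "\<theta> t = \<pi>0 x"
      using surj \<pi>0_closed[OF x] by (metis imageE)
    then show ?thesis
      using I_group_memI[OF _ x] by (intro image_eqI[of _ _ "(t, \<rho> x)"]) auto
  qed
  then show "snd ` I_group \<theta> = \<rho> ` carrier G0"
    by (auto elim!: I_group_memE)
qed

lemma I_group_fst:
  assumes "g \<in> I_group \<theta>"
  shows "\<theta> (fst g) = \<pi>0 (to_G0 G0 \<rho> g)"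
  using assms by (auto simp: to_G0_\<rho> elim!: I_group_memE)

lemma cocycle_map_I_group:
  assumes "\<theta> \<in> perm_ext_maps n G0 \<rho> A"
  shows "cocycle_map (I_group \<theta>) = \<theta>"
proof -
  interpret I_type_over G0 A \<pi>0 n \<rho> "I_group \<theta>"
    by (rule I_group_I_type_over[OF assms])
  show ?thesis
  proof (rule extensionalityI[of _ "carrier P"])
    show "\<theta> \<in> extensional (carrier P)"
      by (rule perm_ext_mapsD(3)[OF assms])
    show "cocycle_map (I_group \<theta>) \<in> extensional (carrier P)"
      by (simp add: cocycle_map_def)
    fix t assume "t \<in> carrier P"
    then obtain g where "g \<in> I_group \<theta>" "t = fst g"
      by (rule fst_surjE)
    then show "cocycle_map (I_group \<theta>) t = \<theta> t"
      by (simp add: cocycle_map_fst I_group_fst)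
  qed
qed

end

text \<open>Keeping \<open>\<theta>\<close> as a parameter lets one locale serve both directions: a
  given \<open>G\<close> with \<open>cocycle_map G\<close>, and \<open>I_group \<theta>\<close> with
  a given \<open>\<theta>\<close>.\<close>

locale I_type_extension = I_type_over G0 A \<pi>0 n \<rho> G
  for G0 :: "('g, 'b) monoid_scheme" and A :: "('g, 'a) gmod" and \<pi>0 n \<rho> G +
  fixes \<theta> :: "(nat \<Rightarrow> int) \<Rightarrow> 'a"
  assumes \<theta>: "\<theta> \<in> perm_ext_maps n G0 \<rho> A"
    and \<theta>_fst: "g \<in> G \<Longrightarrow> \<theta> (fst g) = \<pi>0 (to_G0 G0 \<rho> g)"
begin

abbreviation "K \<equiv> act_kernel n G"
abbreviation "N \<equiv> ker_module n \<rho> A \<theta>"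
abbreviation "j \<equiv> inv_into K fst"

sublocale ext: gmod_extension G0 A N P id \<theta>
  by (rule perm_ext_map_gmod_extension[OF \<theta>])

lemma N_carrier: "carrier N = kernel P A \<theta>"
  by (simp add: ker_module_eq)

text \<open>As \<open>\<pi>0\<close> is injective and vanishes at the identity,
  \<open>\<theta> (fst g)\<close> is zero exactly when \<open>q g\<close> is trivial.\<close>

lemma fst_image_act_kernel: "fst ` K = kernel P A \<theta>"
proof -
  have "\<theta> (fst g) = \<one>\<^bsub>A\<^esub> \<longleftrightarrow> q g = \<one>\<^bsub>G0\<^esub>" if "g \<in> G" for g
    using \<pi>0_eq_iff[OF q_closed[OF that] A.G.one_closed] by (simp add: \<theta>_fst that \<pi>0_one)
  then show ?thesis
    unfolding kernel_def fst_image[symmetric] by (auto simp: act_kernel_iff)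
qed

lemma fst_bij_kernel: "bij_betw fst K (carrier N)"
  unfolding bij_betw_def N_carrier
  using fst_image_act_kernel inj_on_subset[OF fst_inj act_kernel_subset] by blast

lemma fst_kernel_iso: "fst \<in> iso ((ZnSn n)\<lparr>carrier := K\<rparr>) N"
proof (rule isoI)
  show "bij_betw fst (carrier ((ZnSn n)\<lparr>carrier := K\<rparr>)) (carrier N)"
    using fst_bij_kernel by simp
  show "fst \<in> hom ((ZnSn n)\<lparr>carrier := K\<rparr>) N"
    using fst_kernel_hom fst_bij_kernel by (auto simp: hom_def ker_module_def bij_betw_def)
qed

text \<open>Since the kernel of \<open>\<theta>\<close> is the image of \<open>K\<close>, the
  isomorphism induced by \<open>\<theta>\<close> on the quotient is the required one.\<close>

lemma has_assoc: "has_assoc_I_datum n G G0 \<rho> A \<pi>0"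
proof -
  obtain f where "f \<in> gmod_iso G0 (quotient_gmod P (kernel P A \<theta>)) A"
    and "\<And>t. t \<in> carrier P \<Longrightarrow> f (kernel P A \<theta> #>\<^bsub>P\<^esub> t) = \<theta> t"
    using P.quotient_kernel_iso[OF A.gmodule_axioms perm_ext_mapsD(1,2)[OF \<theta>]] by blast
  moreover have "kernel P A \<theta> #>\<^bsub>Zn n\<^esub> t = kernel P A \<theta> #>\<^bsub>P\<^esub> t" for t
    by (simp add: r_coset_def)
  ultimately show ?thesis
    unfolding has_assoc_I_datum_def fst_image_act_kernel
    using snd_image \<theta>_fst fst_closed by metis
qed

section \<open>The group extension and its class\<close>

lemma
  assumes "m \<in> carrier N"
  shows j_closed: "j m \<in> K" and fst_j: "fst (j m) = m"
  using bij_betwE[OF bij_betw_inv_into[OF fst_bij_kernel]] bij_betw_inv_into_right[OF fst_bij_kernel]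
    assms by auto

lemma j_in_G: "m \<in> carrier N \<Longrightarrow> j m \<in> G"
  using j_closed act_kernel_subset by blast

lemma j_hom: "j \<in> hom N \<Gamma>" and j_inj: "inj_on j (carrier N)" and j_image: "j ` carrier N = K"
proof -
  have iso: "j \<in> iso N ((ZnSn n)\<lparr>carrier := K\<rparr>)"
    using group.iso_set_sym[OF act_kernel_group fst_kernel_iso] by simp
  then show "j \<in> hom N \<Gamma>"
    using act_kernel_subset by (auto simp: iso_def hom_def)
  show "inj_on j (carrier N)" "j ` carrier N = K"
    using iso by (auto simp: iso_def bij_betw_def)
qed

lemma is_group_extension: "group_extension G0 N \<Gamma> j q"
proof -
  \<comment> \<open>Equivalent to \<open>e k = k' e\<close>, where \<open>k\<close> and
    \<open>k'\<close> are the elements of \<open>K\<close> over \<open>m\<close> and its translate.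
    Under \<open>fst\<close> the sides become \<open>fst e + (q e) m\<close> and
    \<open>(q e) m + fst e\<close>, equal because Z^n is commutative.\<close>
  have conj: "j (act N (q e) m) = e \<otimes>\<^bsub>\<Gamma>\<^esub> j m \<otimes>\<^bsub>\<Gamma>\<^esub> inv\<^bsub>\<Gamma>\<^esub> e"
    if e: "e \<in> G" and m: "m \<in> carrier N" for e m
  proof -
    have m': "act N (q e) m \<in> carrier N"
      by (rule ext.M.act_closed[OF q_closed[OF e] m])
    have mP: "m \<in> carrier P" "act P (q e) m \<in> carrier P"
      using fst_closed[OF j_in_G[OF m]] fst_j[OF m] P.act_closed[OF q_closed[OF e]] by auto
    have act_eq: "act N (q e) m = act P (q e) m"
      by (simp add: ker_module_def)
    have "fst (e \<otimes>\<^bsub>ZnSn n\<^esub> j m) = fst e \<otimes>\<^bsub>P\<^esub> act P (q e) m"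
      by (simp only: fst_mult[OF e j_in_G[OF m]] fst_j[OF m])
    also have "\<dots> = act N (q e) m \<otimes>\<^bsub>P\<^esub> fst e"
      unfolding act_eq by (rule P.M.m_comm[OF fst_closed[OF e] mP(2)])
    also have "\<dots> = fst (j (act N (q e) m) \<otimes>\<^bsub>ZnSn n\<^esub> e)"
      by (simp only: fst_mult_kernel[OF j_closed[OF m'] e] fst_j[OF m'])
    finally have "e \<otimes>\<^bsub>ZnSn n\<^esub> j m = j (act N (q e) m) \<otimes>\<^bsub>ZnSn n\<^esub> e"
      by (rule inj_onD[OF fst_inj]) (use e j_in_G[OF m] j_in_G[OF m'] in auto)
    then show ?thesis
      using \<Gamma>.inv_solve_right[of "j (act N (q e) m)" "e \<otimes>\<^bsub>\<Gamma>\<^esub> j m" e] e j_in_G[OF m] j_in_G[OF m']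
      by simp
  qed
  then show ?thesis
    unfolding group_extension_def mon_def epi_def
    using ext.M.gmodule_axioms \<Gamma>.is_group j_hom j_inj j_image q_hom q_image act_kernel_eq
    by simp
qed

text \<open>With \<open>x\<close> the preimage of \<open>a\<close> under \<open>\<pi>0\<close>,
  \<open>\<theta> (fst (S x)) = \<pi>0 (q (S x)) = \<pi>0 x = a\<close>.\<close>

lemma section_of_\<theta>:
  assumes S: "S \<in> set_sections q G (carrier G0)"
  shows "fst \<circ> S \<circ> inv_into (carrier G0) \<pi>0 \<in> set_sections \<theta> (carrier P) (carrier A)"
proof -
  have "S (inv_into (carrier G0) \<pi>0 a) \<in> G \<and>
      q (S (inv_into (carrier G0) \<pi>0 a)) = inv_into (carrier G0) \<pi>0 a \<and>
      \<pi>0 (inv_into (carrier G0) \<pi>0 a) = a" if "a \<in> carrier A" for a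
    using S that bij_betwE[OF bij_betw_inv_into[OF \<pi>0_bij]] bij_betw_inv_into_right[OF \<pi>0_bij]
    by (auto simp: set_sections_def Pi_iff)
  then show ?thesis
    using fst_closed by (simp add: set_sections_def \<theta>_fst)
qed

text \<open>Elements of \<open>G\<close> are compared through the injective cocycle \<^const>\<open>fst\<close>.\<close>
lemma section_cocycle_eq_splice:
  assumes S: "S \<in> set_sections q G (carrier G0)"
  shows "(\<lambda>(g, h)\<in>carrier G0 \<times> carrier G0.
      inv_into (carrier N) j (S g \<otimes>\<^bsub>\<Gamma>\<^esub> S h \<otimes>\<^bsub>\<Gamma>\<^esub> inv\<^bsub>\<Gamma>\<^esub> S (g \<otimes>\<^bsub>G0\<^esub> h)))
    = splice_cocycle G0 N P id (fst \<circ> S \<circ> inv_into (carrier G0) \<pi>0) \<pi>0"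
proof -
  \<comment> \<open>The inverse of \<open>\<pi>0\<close> is undone by composing with
    \<open>\<pi>0\<close>, so on \<open>G0\<close> this is just
    \<open>fst \<circ> S\<close>.\<close>
  define u where "u = fst \<circ> S \<circ> inv_into (carrier G0) \<pi>0 \<circ> \<pi>0"
  have u: "u \<in> ext.lifts \<pi>0"
    unfolding u_def by (rule ext.section_lift[OF section_of_\<theta>[OF S] \<pi>0_Z1])
  have u_eq: "u g = fst (S g)" if "g \<in> carrier G0" for g
    using that bij_betw_inv_into_left[OF \<pi>0_bij] by (simp add: u_def)
  have SG: "S g \<in> G" and qS: "q (S g) = g" if "g \<in> carrier G0" for g
    using S that by (auto simp: set_sections_def)
  have "inv_into (carrier N) j (S g \<otimes>\<^bsub>\<Gamma>\<^esub> S h \<otimes>\<^bsub>\<Gamma>\<^esub> inv\<^bsub>\<Gamma>\<^esub> S (g \<otimes>\<^bsub>G0\<^esub> h))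
      = ext.lift_cocycle u (g, h)" if g: "g \<in> carrier G0" and h: "h \<in> carrier G0" for g h
  proof -
    define v where "v = ext.lift_cocycle u (g, h)"
    note gh = A.G.m_closed[OF g h]
    have v: "v \<in> carrier N"
      unfolding v_def by (rule ext.lift_cocycle_closed[OF \<pi>0_Z1 u g h])
    have vP: "v \<in> carrier P"
      using fst_closed[OF j_in_G[OF v]] fst_j[OF v] by simp
    have "v = u g \<otimes>\<^bsub>P\<^esub> act P g (u h) \<otimes>\<^bsub>P\<^esub> inv\<^bsub>P\<^esub> u (g \<otimes>\<^bsub>G0\<^esub> h)"
      using ext.i_lift_cocycle[OF \<pi>0_Z1 u g h] unfolding v_def id_apply .
    then have "v \<otimes>\<^bsub>P\<^esub> u (g \<otimes>\<^bsub>G0\<^esub> h) = u g \<otimes>\<^bsub>P\<^esub> act P g (u h)"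
      using P.M.inv_solve_right[of v "u g \<otimes>\<^bsub>P\<^esub> act P g (u h)" "u (g \<otimes>\<^bsub>G0\<^esub> h)"] vP
        P.M.m_closed P.act_closed[OF g] ext.lift_closed[OF \<pi>0_Z1 u] g h gh by metis
    \<comment> \<open>Since \<open>j v\<close> acts trivially, the left side is
      \<open>v + u(gh)\<close>; the right side is \<open>u(g) + g u(h)\<close> by the cocycle
      identity for \<open>fst\<close>.\<close>
    then have "fst (j v \<otimes>\<^bsub>ZnSn n\<^esub> S (g \<otimes>\<^bsub>G0\<^esub> h)) = fst (S g \<otimes>\<^bsub>ZnSn n\<^esub> S h)"
      by (simp only: fst_mult_kernel[OF j_closed[OF v] SG[OF gh]] fst_mult[OF SG[OF g] SG[OF h]]
          fst_j[OF v] qS[OF g] u_eq[OF g] u_eq[OF h] u_eq[OF gh])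
    then have "j v \<otimes>\<^bsub>ZnSn n\<^esub> S (g \<otimes>\<^bsub>G0\<^esub> h) = S g \<otimes>\<^bsub>ZnSn n\<^esub> S h"
      by (rule inj_onD[OF fst_inj]) (use SG g h gh j_in_G[OF v] in auto)
    then have "S g \<otimes>\<^bsub>\<Gamma>\<^esub> S h \<otimes>\<^bsub>\<Gamma>\<^esub> inv\<^bsub>\<Gamma>\<^esub> S (g \<otimes>\<^bsub>G0\<^esub> h) = j v"
      using \<Gamma>.inv_solve_right[of "j v" "S g \<otimes>\<^bsub>\<Gamma>\<^esub> S h" "S (g \<otimes>\<^bsub>G0\<^esub> h)"] SG g h gh j_in_G[OF v]
      by simp
    then show ?thesis
      using inv_into_f_f[OF j_inj v] by (simp only: v_def)
  qed
  then show ?thesis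
    unfolding ext.splice_cocycle_eq u_def[symmetric]
    by (intro extensionalityI[of _ "carrier G0 \<times> carrier G0"]) (auto simp: ext.lift_cocycle_def)
qed

lemma extension_class_eq_splice:
  "extension_class G0 N \<Gamma> j q = yoneda_splice G0 A N (Ext1_class G0 A N (P, id, \<theta>)) (H1_class G0 A \<pi>0)"
  (is "_ = ?splice")
proof -
  have "extension_class G0 N \<Gamma> j q = (\<Union>S\<in>set_sections q G (carrier G0). ?splice)"
    unfolding extension_class_def
  proof (rule SUP_cong)
    show "H2_class G0 N (\<lambda>(g, h)\<in>carrier G0 \<times> carrier G0.
      inv_into (carrier N) j (S g \<otimes>\<^bsub>\<Gamma>\<^esub> S h \<otimes>\<^bsub>\<Gamma>\<^esub> inv\<^bsub>\<Gamma>\<^esub> S (g \<otimes>\<^bsub>G0\<^esub> h))) = ?splice"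
      if S: "S \<in> set_sections q G (carrier G0)" for S
      unfolding section_cocycle_eq_splice[OF S] ext.yoneda_splice_eq[OF \<pi>0_Z1 section_of_\<theta>[OF S]] ..
  qed simp
  then show ?thesis
    using set_sections_nonempty[OF q_image] by simp
qed

end

theorem theorem4p6:
  fixes G0 :: "('g, 'b) monoid_scheme" and A :: "('g, 'a) gmod" and \<pi>0 :: "'g \<Rightarrow> 'a"
    and n :: nat and \<rho> :: "'g \<Rightarrow> nat \<Rightarrow> nat"
  assumes "finite (carrier G0)" and "finite (carrier A)" and "gmodule G0 A"
    and "\<pi>0 \<in> Z1 G0 A" and "bij_betw \<pi>0 (carrier G0) (carrier A)"
    and "\<rho> \<in> mon G0 (sym_group n)"
  shows "\<exists>\<Theta>. bij_betw \<Theta> {G. I_type n G \<and> has_assoc_I_datum n G G0 \<rho> A \<pi>0}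
                       (perm_ext_maps n G0 \<rho> A) \<and>
    (\<forall>G. I_type n G \<and> has_assoc_I_datum n G G0 \<rho> A \<pi>0 \<longrightarrow>
      (let \<theta> = \<Theta> G; K = act_kernel n G; kerM = ker_module n \<rho> A \<theta>;
           grpG = (ZnSn n)\<lparr>carrier := G\<rparr>; j = inv_into K fst; q = to_G0 G0 \<rho>;
           \<gamma> = perm_ext_class n G0 \<rho> A \<theta>; splice = yoneda_splice G0 A kerM \<gamma> (H1_class G0 A \<pi>0)
       in fst \<in> iso ((ZnSn n)\<lparr>carrier := K\<rparr>) kerM \<and>
          (\<forall>g\<in>G. \<theta> (fst g) = \<pi>0 (q g)) \<and>
          \<gamma> \<in> Ext1 G0 A kerM \<and>
          splice \<in> carrier (H2 G0 kerM) \<and>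
          group_extension G0 kerM grpG j q \<and>
          extension_class G0 kerM grpG j q = splice))"
proof -
  interpret I_datum G0 A \<pi>0 n \<rho>
    using assms by (intro I_datum.intro I_datum_axioms.intro)
  let ?\<G> = "{G. I_type n G \<and> has_assoc_I_datum n G G0 \<rho> A \<pi>0}"
  have over: "I_type_over G0 A \<pi>0 n \<rho> G" if "G \<in> ?\<G>" for G
    using that by unfold_locales (auto simp: has_assoc_I_datum_def)
  have map: "cocycle_map G \<in> perm_ext_maps n G0 \<rho> A" if "G \<in> ?\<G>" for G
    using I_type_over.cocycle_map_perm_ext[OF over[OF that]] that by blast
  have extension: "I_type_extension G0 A \<pi>0 n \<rho> G (cocycle_map G)" if "G \<in> ?\<G>" for G
    using over[OF that] map[OF that] I_type_over.cocycle_map_fst[OF over[OF that]]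
    by (intro I_type_extension.intro I_type_extension_axioms.intro)
  \<comment> \<open>Needed for \<open>I_group\<close> to be a two-sided inverse: the group built
    from \<open>\<theta>\<close> must again have the prescribed associated I-datum.\<close>
  have "I_group \<theta> \<in> ?\<G>" if \<theta>: "\<theta> \<in> perm_ext_maps n G0 \<rho> A" for \<theta>
  proof -
    interpret I_type_extension G0 A \<pi>0 n \<rho> "I_group \<theta>" \<theta>
      by (intro I_type_extension.intro I_type_extension_axioms.intro I_group_I_type_over \<theta> I_group_fst)
    show ?thesis
      using I_type has_assoc by simp
  qed
  then have "bij_betw cocycle_map ?\<G> (perm_ext_maps n G0 \<rho> A)"
    using map I_type_over.I_group_cocycle_map[OF over] cocycle_map_I_group
    by (intro bij_betw_byWitness[of _ I_group]) auto
  moreover have "let \<theta> = cocycle_map G; K = act_kernel n G; kerM = ker_module n \<rho> A \<theta>;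
           grpG = (ZnSn n)\<lparr>carrier := G\<rparr>; j = inv_into K fst; q = to_G0 G0 \<rho>;
           \<gamma> = perm_ext_class n G0 \<rho> A \<theta>; splice = yoneda_splice G0 A kerM \<gamma> (H1_class G0 A \<pi>0)
       in fst \<in> iso ((ZnSn n)\<lparr>carrier := K\<rparr>) kerM \<and>
          (\<forall>g\<in>G. \<theta> (fst g) = \<pi>0 (q g)) \<and>
          \<gamma> \<in> Ext1 G0 A kerM \<and>
          splice \<in> carrier (H2 G0 kerM) \<and>
          group_extension G0 kerM grpG j q \<and>
          extension_class G0 kerM grpG j q = splice"
    if "G \<in> ?\<G>" for G
  proof -
    interpret I_type_extension G0 A \<pi>0 n \<rho> G "cocycle_map G"
      by (rule extension[OF that])
    show ?thesis
      unfolding Let_def perm_ext_class_def perm_extension_def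
      using fst_kernel_iso \<theta>_fst ext.Ext1_class_in_Ext1 ext.yoneda_splice_in_H2[OF \<pi>0_Z1]
        is_group_extension extension_class_eq_splice by blast
  qed
  ultimately show ?thesis
    by blast
qed

end
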